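(* Let $H$ be a Hopf algebra over a field $k$ with invertible antipode $S$, and let $B\#_\sigma H$ be a cocycle cross product of associative type. Then the linear map $\mathsf{S}:B^e\#_\sigma H\to B^e\#_\sigma H$ given by $$\mathsf{S}(b\otimes b'\#_\sigma h)=b'\otimes\sigma^{-1}(S^2(h_{(2)}),S(h_{(1)}))\,(S^2(h_{(3)})\triangleright b)\,\#_\sigma S(h_{(4)}),$$ with inverse $$\mathsf{S}^{-1}(b\otimes b'\#_\sigma h)=(h_{(2)}\triangleright b')\,\sigma(h_{(3)},S(h_{(4)}))\otimes b\,\#_\sigma S^{-1}(h_{(1)}),$$ is a left antipode for the left Hopf algebroid $B^e\#_\sigma H$.
   Context: Sumless Sweedler notation is used; $B^e=B\otimes B^{op}$. Cocycle cross product: a linear map $\triangleright:H\otimes B\to B$ with $h\triangleright(ab)=(h_{(1)}\triangleright a)(h_{(2)}\triangleright b)$, $h\triangleright 1=\epsilon(h)1$ (a measuring), and a convolution-invertible $\sigma:H\otimes H\to B$ (inverse $\sigma^{-1}$) with (1) $1\triangleright b=b$; (2) $h\triangleright(g\triangleright b)=\sigma(h_{(1)},g_{(1)})(h_{(2)}g_{(2)}\triangleright b)\sigma^{-1}(h_{(3)},g_{(3)})$; (3) $\sigma(h,1)=\sigma(1,h)=\epsilon(h)1$; (4) $(h_{(1)}\triangleright\sigma(g_{(1)},f_{(1)}))\sigma(h_{(2)},g_{(2)}f_{(2)})=\sigma(h_{(1)},g_{(1)})\sigma(h_{(2)}g_{(2)},f)$. Then $B\#_\sigma H$ is $B\otimes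 H$ with product $(b\#_\sigma h)(c\#_\sigma g)=b(h_{(1)}\triangleright c)\sigma(h_{(2)},g_{(1)})\#_\sigma h_{(3)}g_{(2)}$. It is of associative type if $B$ is an $H$-module algebra under $\triangleright$ (i.e. $\triangleright$ is also an action). $B^e\#_\sigma H$ is the left $B$-bialgebroid on $B^e\otimes H$ with product $(b\otimes b'\#_\sigma h)(c\otimes c'\#_\sigma g)=b(h_{(1)}\triangleright c)\sigma(h_{(2)},g_{(1)})\otimes c'(S(g_{(4)})\triangleright b')\sigma(S(g_{(3)}),S(h_{(4)}))\#_\sigma h_{(3)}g_{(2)}$, $s(b)=b\otimes1\#_\sigma1$, $t(b)=1\otimes b\#_\sigma1$, coproduct $\Delta(b\otimes b'\#_\sigma h)=(b\otimes\sigma^{-1}(S(h_{(2)}),h_{(3)})\#_\sigma h_{(1)})\otimes_B(1\otimes b'\#_\sigma h_{(4)})$, counit $\epsilon(b\otimes b'\#_\sigma h)=b(h_{(1)}\triangleright b')\sigma(h_{(2)},S(h_{(3)}))$; here $t(b)X\otimes_BY=X\otimes_Bs(b)Y$. Left antipode of a left $B$-bialgebroid $\mathcal{L}$: an invertible linear map $\mathsf{S}:\mathcal{L}\to\mathcal{L}$ such that for all $X\in\mathcal{L}$, $b\in B$: (1) $\mathsf{S}(t(b)X)=\mathsf{S}(X)s(b)$ and $\mathsf{S}^{-1}(s(b)X)=\mathsf{S}^{-1}(X)t(b)$; (2) $\mathsf{S}^{-1}(X_{(2)})_{(1)}\otimes_B\mathsf{S}^{-1}(X_{(2)})_{(2)}X_{(1)}=\mathsf{S}^{-1}(X)\otimes_B1$;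 (3) $\mathsf{S}(X_{(1)})_{(1)}X_{(2)}\otimes_B\mathsf{S}(X_{(1)})_{(2)}=1\otimes_B\mathsf{S}(X)$. *)

theory Defs
  imports Complex_Main "HOL-Library.Poly_Mapping"
begin

(* Free vector spaces and linear quotients.
   The free k-vector space on a type 'x is the type 'x \<Rightarrow>\<^sub>0 'k of finitely supported functions. *)

definition fscale :: "'k::field \<Rightarrow> ('x \<Rightarrow>\<^sub>0 'k) \<Rightarrow> ('x \<Rightarrow>\<^sub>0 'k)"
  where "fscale c u = Poly_Mapping.map ((*) c) u"

abbreviation pt :: "'x \<Rightarrow> ('x \<Rightarrow>\<^sub>0 'k::field)"
  where "pt x \<equiv> Poly_Mapping.single x 1"

definition lin_ext ::
  "('k::field \<Rightarrow> 'w::ab_group_add \<Rightarrow> 'w) \<Rightarrow> ('x \<Rightarrow> 'w) \<Rightarrow> ('x \<Rightarrow>\<^sub>0 'k) \<Rightarrow> 'w"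
  where "lin_ext sc f u = (\<Sum>x\<in>Poly_Mapping.keys u. sc (Poly_Mapping.lookup u x) (f x))"

lemma lookup_fscale: "Poly_Mapping.lookup (fscale c u) x = c * Poly_Mapping.lookup u x"
  unfolding fscale_def by (simp add: Poly_Mapping.map.rep_eq when_def)

lemma vector_space_fscale: "vector_space (fscale :: 'k::field \<Rightarrow> ('x \<Rightarrow>\<^sub>0 'k) \<Rightarrow> _)"
  by (rule vector_space.intro)
    (auto intro!: poly_mapping_eqI simp: lookup_fscale lookup_add algebra_simps)

(* The quotient of the free vector space by the subspace spanned by G is realised inside the free
   vector space: quot_map G is a linear projection with kernel span G, so that its range, with
   quot_map G as the quotient map, is a copy of the quotient (see quot_map_eq_iff).  An element of
   the quotient is thereby also a formal linear combination representing its own class. *)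

definition quot_map :: "('x \<Rightarrow>\<^sub>0 'k::field) set \<Rightarrow> ('x \<Rightarrow>\<^sub>0 'k) \<Rightarrow> ('x \<Rightarrow>\<^sub>0 'k)"
  where "quot_map G = (SOME p. Vector_Spaces.linear fscale fscale p \<and> (\<forall>u. p (p u) = p u)
           \<and> (\<forall>u. p u = 0 \<longleftrightarrow> u \<in> module.span fscale G))"

lemma quot_map:
  fixes G :: "('x \<Rightarrow>\<^sub>0 'k::field) set"
  shows linear_quot_map: "Vector_Spaces.linear fscale fscale (quot_map G)"
    and quot_map_idem: "quot_map G (quot_map G u) = quot_map G u"
    and quot_map_eq_0_iff: "quot_map G u = 0 \<longleftrightarrow> u \<in> module.span fscale G"
proof -
  interpret vector_space "fscale :: 'k \<Rightarrow> ('x \<Rightarrow>\<^sub>0 'k) \<Rightarrow> _" by (rule vector_space_fscale)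
  interpret vector_space_pair "fscale :: 'k \<Rightarrow> ('x \<Rightarrow>\<^sub>0 'k) \<Rightarrow> _" "fscale :: 'k \<Rightarrow> ('x \<Rightarrow>\<^sub>0 'k) \<Rightarrow> _" ..
  obtain q where q: "range q \<subseteq> span G" "Vector_Spaces.linear fscale fscale q"
      "\<forall>v\<in>span G. q v = v"
    using linear_exists_left_inverse_on[OF linear_ident subspace_span, of G] by auto
  interpret q: Vector_Spaces.linear "fscale :: 'k \<Rightarrow> ('x \<Rightarrow>\<^sub>0 'k) \<Rightarrow> _" "fscale :: 'k \<Rightarrow> ('x \<Rightarrow>\<^sub>0 'k) \<Rightarrow> _" q
    by (rule q(2))
  have qs: "q u \<in> span G" for u using q(1) by auto
  have "\<exists>p. Vector_Spaces.linear fscale fscale p \<and> (\<forall>u. p (p u) = p u)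
           \<and> (\<forall>u. p u = 0 \<longleftrightarrow> u \<in> span G)"
  proof (intro exI[of _ "\<lambda>u. u - q u"] conjI allI)
    show "Vector_Spaces.linear fscale fscale (\<lambda>u. u - q u)"
      by (intro linear_compose_sub linear_ident q(2))
    show "u - q u - q (u - q u) = u - q u" for u
      using qs q(3) by (simp add: q.diff)
    show "u - q u = 0 \<longleftrightarrow> u \<in> span G" for u
      using qs[of u] q(3) by auto
  qed
  from someI_ex[OF this, folded quot_map_def]
  show "Vector_Spaces.linear fscale fscale (quot_map G)"
    "quot_map G (quot_map G u) = quot_map G u"
    "quot_map G u = 0 \<longleftrightarrow> u \<in> span G" by blast+
qed

lemma quot_map_eq_iff: "quot_map G u = quot_map G v \<longleftrightarrow> u - v \<in> module.span fscale G"
proof -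
  interpret p: Vector_Spaces.linear fscale fscale "quot_map G" by (rule linear_quot_map)
  show ?thesis using quot_map_eq_0_iff[of G "u - v"] by (simp add: p.diff)
qed

lemma linear_iff_expanded:
  "Vector_Spaces.linear s1 s2 f \<longleftrightarrow> vector_space s1 \<and> vector_space s2 \<and>
     (\<forall>x y. f (x + y) = f x + f y) \<and> (\<forall>c x. f (s1 c x) = s2 c (f x))"
  by (auto simp: Vector_Spaces.linear_def module_hom_iff module_iff_vector_space)

lemma linear_lin_ext:
  assumes "vector_space sc"
  shows "Vector_Spaces.linear fscale sc (lin_ext sc f)"
proof -
  interpret vector_space sc by fact
  have ext: "lin_ext sc f u = (\<Sum>x\<in>A. sc (Poly_Mapping.lookup u x) (f x))"
    if "finite A" "Poly_Mapping.keys u \<subseteq> A" for u A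
    unfolding lin_ext_def using that by (intro sum.mono_neutral_left) (auto simp: in_keys_iff)
  show ?thesis
    unfolding linear_iff_expanded
  proof (intro conjI allI vector_space_fscale assms)
    fix u v :: "'c \<Rightarrow>\<^sub>0 'a" and c :: 'a
    let ?A = "Poly_Mapping.keys u \<union> Poly_Mapping.keys v \<union> Poly_Mapping.keys (u + v)
      \<union> Poly_Mapping.keys (fscale c u)"
    have fA: "finite ?A" by simp
    show "lin_ext sc f (u + v) = lin_ext sc f u + lin_ext sc f v"
      by (simp add: ext[OF fA] le_supI1 le_supI2 lookup_add scale_left_distrib sum.distrib)
    show "lin_ext sc f (fscale c u) = sc c (lin_ext sc f u)"
      by (simp add: ext[OF fA] le_supI1 le_supI2 lookup_fscale scale_sum_right)
  qed
qed

lemma lin_ext_quot_map: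
  assumes "vector_space sc" and "\<And>g. g \<in> G \<Longrightarrow> lin_ext sc f g = 0"
  shows "lin_ext sc f (quot_map G u) = lin_ext sc f u"
proof -
  interpret l: Vector_Spaces.linear fscale sc "lin_ext sc f"
    by (rule linear_lin_ext) fact
  have "quot_map G u - u \<in> module.span fscale G"
    using quot_map_eq_iff[of G "quot_map G u" u] by (simp add: quot_map_idem)
  hence "lin_ext sc f (quot_map G u - u) = 0"
    using assms(2) by (rule l.eq_0_on_span[rotated])
  thus ?thesis by (simp add: l.diff)
qed

(* Tensor products: free vector space on tuples modulo the multilinearity relations.
   In bilin_rels the two factors are the subspaces A and C. *)

definition bilin_rels ::
  "'a set \<Rightarrow> ('k::field \<Rightarrow> 'a::ab_group_add \<Rightarrow> 'a) \<Rightarrow> 'c set \<Rightarrow> ('k \<Rightarrow> 'c::ab_group_add \<Rightarrow> 'c)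
    \<Rightarrow> ('a \<times> 'c \<Rightarrow>\<^sub>0 'k) set"
  where "bilin_rels A sA C sC =
      {pt (x + x', y) - pt (x, y) - pt (x', y) | x x' y. x \<in> A \<and> x' \<in> A \<and> y \<in> C}
    \<union> {pt (x, y + y') - pt (x, y) - pt (x, y') | x y y'. x \<in> A \<and> y \<in> C \<and> y' \<in> C}
    \<union> {pt (sA r x, y) - fscale r (pt (x, y)) | r x y. x \<in> A \<and> y \<in> C}
    \<union> {pt (x, sC r y) - fscale r (pt (x, y)) | r x y. x \<in> A \<and> y \<in> C}"

definition tens2 ::
  "('k::field \<Rightarrow> 'a::ab_group_add \<Rightarrow> 'a) \<Rightarrow> ('k \<Rightarrow> 'c::ab_group_add \<Rightarrow> 'c) \<Rightarrow> 'a \<Rightarrow> 'c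
    \<Rightarrow> ('a \<times> 'c \<Rightarrow>\<^sub>0 'k)"
  where "tens2 sA sC x y = quot_map (bilin_rels UNIV sA UNIV sC) (pt (x, y))"

definition tens2_space ::
  "('k::field \<Rightarrow> 'a::ab_group_add \<Rightarrow> 'a) \<Rightarrow> ('k \<Rightarrow> 'c::ab_group_add \<Rightarrow> 'c)
    \<Rightarrow> ('a \<times> 'c \<Rightarrow>\<^sub>0 'k) set"
  where "tens2_space sA sC = range (quot_map (bilin_rels UNIV sA UNIV sC))"

definition trilin_rels ::
  "('k::field \<Rightarrow> 'a::ab_group_add \<Rightarrow> 'a) \<Rightarrow> ('k \<Rightarrow> 'c::ab_group_add \<Rightarrow> 'c)
    \<Rightarrow> ('k \<Rightarrow> 'd::ab_group_add \<Rightarrow> 'd) \<Rightarrow> ('a \<times> 'c \<times> 'd \<Rightarrow>\<^sub>0 'k) set"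
  where "trilin_rels sA sC sD =
      {pt (x + x', y, z) - pt (x, y, z) - pt (x', y, z) | x x' y z. True}
    \<union> {pt (x, y + y', z) - pt (x, y, z) - pt (x, y', z) | x y y' z. True}
    \<union> {pt (x, y, z + z') - pt (x, y, z) - pt (x, y, z') | x y z z'. True}
    \<union> {pt (sA r x, y, z) - fscale r (pt (x, y, z)) | r x y z. True}
    \<union> {pt (x, sC r y, z) - fscale r (pt (x, y, z)) | r x y z. True}
    \<union> {pt (x, y, sD r z) - fscale r (pt (x, y, z)) | r x y z. True}"

definition tens3 ::
  "('k::field \<Rightarrow> 'a::ab_group_add \<Rightarrow> 'a) \<Rightarrow> ('k \<Rightarrow> 'c::ab_group_add \<Rightarrow> 'c)
    \<Rightarrow> ('k \<Rightarrow> 'd::ab_group_add \<Rightarrow> 'd) \<Rightarrow> 'a \<Rightarrow> 'c \<Rightarrow> 'd \<Rightarrow> ('a \<times> 'c \<times> 'd \<Rightarrow>\<^sub>0 'k)"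
  where "tens3 sA sC sD x y z = quot_map (trilin_rels sA sC sD) (pt (x, y, z))"

definition tens3_space ::
  "('k::field \<Rightarrow> 'a::ab_group_add \<Rightarrow> 'a) \<Rightarrow> ('k \<Rightarrow> 'c::ab_group_add \<Rightarrow> 'c)
    \<Rightarrow> ('k \<Rightarrow> 'd::ab_group_add \<Rightarrow> 'd) \<Rightarrow> ('a \<times> 'c \<times> 'd \<Rightarrow>\<^sub>0 'k) set"
  where "tens3_space sA sC sD = range (quot_map (trilin_rels sA sC sD))"

definition bilin ::
  "('k::field \<Rightarrow> 'a::ab_group_add \<Rightarrow> 'a) \<Rightarrow> ('k \<Rightarrow> 'c::ab_group_add \<Rightarrow> 'c)
    \<Rightarrow> ('k \<Rightarrow> 'w::ab_group_add \<Rightarrow> 'w) \<Rightarrow> ('a \<Rightarrow> 'c \<Rightarrow> 'w) \<Rightarrow> bool"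
  where "bilin sA sC sW f \<longleftrightarrow>
    (\<forall>x. Vector_Spaces.linear sC sW (f x)) \<and> (\<forall>y. Vector_Spaces.linear sA sW (\<lambda>x. f x y))"

(* Universal property: lin_ext computes the linear map induced by a multilinear one. *)

lemma lin_ext_pt: "vector_space sc \<Longrightarrow> lin_ext sc f (pt x) = f x"
  by (simp add: lin_ext_def vector_space.vector_space_assms(4))

lemma lin_ext_tens2:
  assumes f: "bilin sA sC sW f"
  shows "lin_ext sW (\<lambda>(x, y). f x y) (tens2 sA sC a c) = f a c"
proof -
  have l: "Vector_Spaces.linear sC sW (f x)" "Vector_Spaces.linear sA sW (\<lambda>x. f x y)" for x y
    using f by (auto simp: bilin_def)
  then have W: "vector_space sW"
    unfolding linear_iff_expanded by blast
  interpret e: Vector_Spaces.linear fscale sW "lin_ext sW (\<lambda>(x, y). f x y)"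
    by (rule linear_lin_ext[OF W])
  note add = l[THEN linear_iff_expanded[THEN iffD1]]
  have "lin_ext sW (\<lambda>(x, y). f x y) (tens2 sA sC a c) = lin_ext sW (\<lambda>(x, y). f x y) (pt (a, c))"
    unfolding tens2_def using add
    by (intro lin_ext_quot_map[OF W])
       (auto simp: bilin_rels_def e.diff e.scale lin_ext_pt[OF W])
  then show ?thesis by (simp add: lin_ext_pt[OF W])
qed

lemma lin_ext_tens3:
  assumes f: "\<And>x. bilin sC sD sW (f x)" "\<And>y z. Vector_Spaces.linear sA sW (\<lambda>x. f x y z)"
  shows "lin_ext sW (\<lambda>(x, y, z). f x y z) (tens3 sA sC sD a c d) = f a c d"
proof -
  have l: "Vector_Spaces.linear sD sW (f x y)" "Vector_Spaces.linear sC sW (\<lambda>y. f x y z)"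
    "Vector_Spaces.linear sA sW (\<lambda>x. f x y z)" for x y z
    using f by (auto simp: bilin_def)
  then have W: "vector_space sW"
    unfolding linear_iff_expanded by blast
  let ?e = "lin_ext sW (\<lambda>(x, y, z). f x y z)"
  interpret e: Vector_Spaces.linear fscale sW ?e
    by (rule linear_lin_ext[OF W])
  note add = l[THEN linear_iff_expanded[THEN iffD1]]
  have "?e (tens3 sA sC sD a c d) = ?e (pt (a, c, d))"
    unfolding tens3_def using add
    by (intro lin_ext_quot_map[OF W])
       (auto simp: trilin_rels_def e.diff e.scale lin_ext_pt[OF W])
  then show ?thesis by (simp add: lin_ext_pt[OF W])
qed

(* Associative unital algebras over a field; sort {ring, monoid_mult} does not exclude 1 = 0. *)

locale k_algebra = vector_space scale
  for scale :: "'k::field \<Rightarrow> 'a::{ring,monoid_mult} \<Rightarrow> 'a" +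
  assumes scale_mult_left: "scale r x * y = scale r (x * y)"
    and scale_mult_right: "x * scale r y = scale r (x * y)"

(* comul h is an element of the tensor product of H with itself, hence a formal linear combination
   of pairs; sw2, sw3, sw4 are the Sweedler notation h(1), h(2), ... in a target space with
   scalar multiplication sc. *)

record (overloaded) ('k, 'h) hopf_data =
  hsc :: "'k \<Rightarrow> 'h \<Rightarrow> 'h"
  comul :: "'h \<Rightarrow> ('h \<times> 'h \<Rightarrow>\<^sub>0 'k)"
  counit :: "'h \<Rightarrow> 'k"
  antip :: "'h \<Rightarrow> 'h"

definition sw2 ::
  "('k::field, 'h) hopf_data \<Rightarrow> ('k \<Rightarrow> 'w::ab_group_add \<Rightarrow> 'w) \<Rightarrow> ('h \<Rightarrow> 'h \<Rightarrow> 'w) \<Rightarrow> 'h \<Rightarrow> 'w"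
  where "sw2 H sc f h = lin_ext sc (\<lambda>(h1, h2). f h1 h2) (comul H h)"

definition sw3 ::
  "('k::field, 'h) hopf_data \<Rightarrow> ('k \<Rightarrow> 'w::ab_group_add \<Rightarrow> 'w) \<Rightarrow> ('h \<Rightarrow> 'h \<Rightarrow> 'h \<Rightarrow> 'w) \<Rightarrow> 'h \<Rightarrow> 'w"
  where "sw3 H sc f h = sw2 H sc (\<lambda>h1. sw2 H sc (f h1)) h"

definition sw4 ::
  "('k::field, 'h) hopf_data \<Rightarrow> ('k \<Rightarrow> 'w::ab_group_add \<Rightarrow> 'w) \<Rightarrow> ('h \<Rightarrow> 'h \<Rightarrow> 'h \<Rightarrow> 'h \<Rightarrow> 'w)
    \<Rightarrow> 'h \<Rightarrow> 'w"
  where "sw4 H sc f h = sw2 H sc (\<lambda>h1. sw3 H sc (f h1)) h"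

locale hopf_algebra = k_algebra "hsc H" for H :: "('k::field, 'h::ring_1) hopf_data" +
  assumes comul_linear: "Vector_Spaces.linear (hsc H) fscale (comul H)"
    and comul_in: "comul H h \<in> tens2_space (hsc H) (hsc H)"
    and coassoc:
      "sw2 H fscale (\<lambda>x y. sw2 H fscale (\<lambda>x1 x2. tens3 (hsc H) (hsc H) (hsc H) x1 x2 y) x) h =
       sw2 H fscale (\<lambda>x y. sw2 H fscale (\<lambda>y1 y2. tens3 (hsc H) (hsc H) (hsc H) x y1 y2) y) h"
    and counit_linear: "Vector_Spaces.linear (hsc H) (*) (counit H)"
    and counit_left: "sw2 H (hsc H) (\<lambda>h1 h2. hsc H (counit H h1) h2) h = h"
    and counit_right: "sw2 H (hsc H) (\<lambda>h1 h2. hsc H (counit H h2) h1) h = h"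
    and comul_mult:
      "comul H (h * g) =
       sw2 H fscale (\<lambda>h1 h2. sw2 H fscale (\<lambda>g1 g2. tens2 (hsc H) (hsc H) (h1 * g1) (h2 * g2)) g) h"
    and comul_one: "comul H 1 = tens2 (hsc H) (hsc H) 1 1"
    and counit_mult: "counit H (h * g) = counit H h * counit H g"
    and counit_one: "counit H 1 = 1"
    and antip_linear: "Vector_Spaces.linear (hsc H) (hsc H) (antip H)"
    and antip_left: "sw2 H (hsc H) (\<lambda>h1 h2. antip H h1 * h2) h = hsc H (counit H h) 1"
    and antip_right: "sw2 H (hsc H) (\<lambda>h1 h2. h1 * antip H h2) h = hsc H (counit H h) 1"

record (overloaded) ('k, 'h, 'b) cocycle_data =
  bsc :: "'k \<Rightarrow> 'b \<Rightarrow> 'b"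
  act :: "'h \<Rightarrow> 'b \<Rightarrow> 'b"
  coc :: "'h \<Rightarrow> 'h \<Rightarrow> 'b"
  cocinv :: "'h \<Rightarrow> 'h \<Rightarrow> 'b"

locale cocycle_cross_product = H: hopf_algebra H + B: k_algebra "bsc C"
  for H :: "('k::field, 'h::ring_1) hopf_data"
    and C :: "('k, 'h, 'b::{ring,monoid_mult}) cocycle_data" +
  assumes act_bilin: "bilin (hsc H) (bsc C) (bsc C) (act C)"
    and act_mult: "act C h (a * b) = sw2 H (bsc C) (\<lambda>h1 h2. act C h1 a * act C h2 b) h"
    and act_on_one: "act C h 1 = bsc C (counit H h) 1"
    and coc_bilin: "bilin (hsc H) (hsc H) (bsc C) (coc C)"
    and cocinv_bilin: "bilin (hsc H) (hsc H) (bsc C) (cocinv C)"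
    and coc_cocinv:
      "sw2 H (bsc C) (\<lambda>h1 h2. sw2 H (bsc C) (\<lambda>g1 g2. coc C h1 g1 * cocinv C h2 g2) g) h =
       bsc C (counit H h * counit H g) 1"
    and cocinv_coc:
      "sw2 H (bsc C) (\<lambda>h1 h2. sw2 H (bsc C) (\<lambda>g1 g2. cocinv C h1 g1 * coc C h2 g2) g) h =
       bsc C (counit H h * counit H g) 1"
    and one_act: "act C 1 b = b"
    and act_act_twisted:
      "act C h (act C g b) =
       sw3 H (bsc C) (\<lambda>h1 h2 h3. sw3 H (bsc C) (\<lambda>g1 g2 g3.
         coc C h1 g1 * act C (h2 * g2) b * cocinv C h3 g3) g) h"
    and coc_one_right: "coc C h 1 = bsc C (counit H h) 1"
    and coc_one_left: "coc C 1 h = bsc C (counit H h) 1"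
    and cocycle:
      "sw2 H (bsc C) (\<lambda>h1 h2. sw2 H (bsc C) (\<lambda>g1 g2. sw2 H (bsc C) (\<lambda>f1 f2.
         act C h1 (coc C g1 f1) * coc C h2 (g2 * f2)) f) g) h =
       sw2 H (bsc C) (\<lambda>h1 h2. sw2 H (bsc C) (\<lambda>g1 g2.
         coc C h1 g1 * coc C (h2 * g2) f) g) h"

locale assoc_cocycle_cross_product = cocycle_cross_product +
  assumes act_act: "act C h (act C g b) = act C (h * g) b"

(* Data of a left bialgebroid over the base algebra 'b, with underlying space car in the type 'l.
   cop takes values in the balanced tensor product spanned by btens below. *)

record ('k, 'b, 'l) base_ring_data =
  car :: "'l set"
  lsc :: "'k \<Rightarrow> 'l \<Rightarrow> 'l"
  lmult :: "'l \<Rightarrow> 'l \<Rightarrow> 'l"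
  lone :: "'l"
  src :: "'b \<Rightarrow> 'l"
  tgt :: "'b \<Rightarrow> 'l"

record (overloaded) ('k, 'b, 'l) bialgebroid_data = "('k, 'b, 'l) base_ring_data" +
  cop :: "'l \<Rightarrow> ('l \<times> 'l \<Rightarrow>\<^sub>0 'k)"
  cou :: "'l \<Rightarrow> 'b"

definition btens ::
  "('k::field, 'b, 'l::ab_group_add, 'z) base_ring_data_scheme \<Rightarrow> 'l \<Rightarrow> 'l \<Rightarrow> ('l \<times> 'l \<Rightarrow>\<^sub>0 'k)"
  where "btens L X Y = quot_map
    (bilin_rels (car L) (lsc L) (car L) (lsc L)
     \<union> {pt (lmult L (tgt L b) U, V) - pt (U, lmult L (src L b) V) | b U V. U \<in> car L \<and> V \<in> car L})
    (pt (X, Y))"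

(* In the last two conditions (X1, X2) runs through the coproduct of X, and (Y1, Y2) through the
   coproduct of the inverse image of X2, respectively of the image of X1. *)

definition left_antipode ::
  "('k::field, 'b, 'l::ab_group_add, 'z) bialgebroid_data_scheme \<Rightarrow> ('l \<Rightarrow> 'l) \<Rightarrow> bool"
  where "left_antipode L S \<longleftrightarrow>
    bij_betw S (car L) (car L) \<and>
    (\<forall>X\<in>car L. \<forall>Y\<in>car L. S (X + Y) = S X + S Y) \<and>
    (\<forall>r. \<forall>X\<in>car L. S (lsc L r X) = lsc L r (S X)) \<and>
    (\<forall>b. \<forall>X\<in>car L. S (lmult L (tgt L b) X) = lmult L (S X) (src L b)) \<and>
    (\<forall>b. \<forall>X\<in>car L. inv_into (car L) S (lmult L (src L b) X) =
       lmult L (inv_into (car L) S X) (tgt L b)) \<and>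
    (\<forall>X\<in>car L.
       lin_ext fscale (\<lambda>(X1, X2). lin_ext fscale (\<lambda>(Y1, Y2). btens L Y1 (lmult L Y2 X1))
         (cop L (inv_into (car L) S X2))) (cop L X)
       = btens L (inv_into (car L) S X) (lone L)) \<and>
    (\<forall>X\<in>car L.
       lin_ext fscale (\<lambda>(X1, X2). lin_ext fscale (\<lambda>(Y1, Y2). btens L (lmult L Y1 X2) Y2)
         (cop L (S X1))) (cop L X)
       = btens L (lone L) (S X))"

(* The bialgebroid on the tensor product of B, B and H (in this order); cr_tens H C b b' h is the
   pure tensor, the second factor being that of the opposite algebra. *)

type_synonym ('k, 'h, 'b) cr = "'b \<times> 'b \<times> 'h \<Rightarrow>\<^sub>0 'k"

definition cr_tens ::
  "('k::field, 'h::ring_1) hopf_data \<Rightarrow> ('k, 'h, 'b::{ring,monoid_mult}) cocycle_data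
    \<Rightarrow> 'b \<Rightarrow> 'b \<Rightarrow> 'h \<Rightarrow> ('k, 'h, 'b) cr"
  where "cr_tens H C = tens3 (bsc C) (bsc C) (hsc H)"

definition cr_mult ::
  "('k::field, 'h::ring_1) hopf_data \<Rightarrow> ('k, 'h, 'b::{ring,monoid_mult}) cocycle_data
    \<Rightarrow> ('k, 'h, 'b) cr \<Rightarrow> ('k, 'h, 'b) cr \<Rightarrow> ('k, 'h, 'b) cr"
  where "cr_mult H C X Y = lin_ext fscale (\<lambda>(b, b', h). lin_ext fscale (\<lambda>(c, c', g).
      sw4 H fscale (\<lambda>h1 h2 h3 h4. sw4 H fscale (\<lambda>g1 g2 g3 g4.
        cr_tens H C
          (b * act C h1 c * coc C h2 g1)
          (c' * act C (antip H g4) b' * coc C (antip H g3) (antip H h4))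
          (h3 * g2)) g) h) Y) X"

definition cr_ring ::
  "('k::field, 'h::ring_1) hopf_data \<Rightarrow> ('k, 'h, 'b::{ring,monoid_mult}) cocycle_data
    \<Rightarrow> ('k, 'b, ('k, 'h, 'b) cr) base_ring_data"
  where "cr_ring H C =
    \<lparr> car = tens3_space (bsc C) (bsc C) (hsc H),
      lsc = fscale,
      lmult = cr_mult H C,
      lone = cr_tens H C 1 1 1,
      src = (\<lambda>b. cr_tens H C b 1 1),
      tgt = (\<lambda>b. cr_tens H C 1 b 1) \<rparr>"

definition cr_bialgebroid ::
  "('k::field, 'h::ring_1) hopf_data \<Rightarrow> ('k, 'h, 'b::{ring,monoid_mult}) cocycle_data
    \<Rightarrow> ('k, 'b, ('k, 'h, 'b) cr) bialgebroid_data"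
  where "cr_bialgebroid H C = base_ring_data.extend (cr_ring H C) (bialgebroid_data.fields
    (\<lambda>X. lin_ext fscale (\<lambda>(b, b', h). sw4 H fscale (\<lambda>h1 h2 h3 h4.
        btens (cr_ring H C)
          (cr_tens H C b (cocinv C (antip H h2) h3) h1)
          (cr_tens H C 1 b' h4)) h) X)
    (\<lambda>X. lin_ext (bsc C) (\<lambda>(b, b', h). sw3 H (bsc C) (\<lambda>h1 h2 h3.
        b * act C h1 b' * coc C h2 (antip H h3)) h) X))"

end

theory Submission
  imports Defs
begin

text \<open>
  Since \<open>B\<close> is an honest \<open>H\<close>-module algebra, the twisted action axiom says that \<open>\<sigma>\<close> and \<open>\<sigma>\<^sup>-\<^sup>1\<close> can be
  moved past \<open>h\<^sub>1 g\<^sub>1 \<rhd> b\<close> in the convolution algebra of \<open>H \<otimes> H\<close>; in the convolution algebra of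
  \<open>H \<otimes> H \<otimes> H\<close> the cocycle condition can be solved for the products of \<open>h\<^sub>1 \<rhd> \<sigma>\<^sup>-\<^sup>1\<close> with \<open>\<sigma>\<close> and of
  \<open>\<sigma>\<^sup>-\<^sup>1\<close> with \<open>h\<^sub>2 \<rhd> \<sigma>\<close>. Evaluated on \<open>S h \<otimes> S\<^sup>2 h \<otimes> S h\<close> and \<open>S h \<otimes> h \<otimes> S h\<close> this gives
  \<open>(S h\<^sub>5 \<rhd> \<sigma>\<^sup>-\<^sup>1(S\<^sup>2 h\<^sub>2, S h\<^sub>1)) \<sigma>(S h\<^sub>4, S\<^sup>2 h\<^sub>3) = \<epsilon>(h)\<close> and
  \<open>\<sigma>\<^sup>-\<^sup>1(S h\<^sub>2, h\<^sub>3) (S h\<^sub>1 \<rhd> \<sigma>(h\<^sub>4, S h\<^sub>5)) = \<epsilon>(h)\<close>, and every antipode axiom collapses to one of these two.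

  In the last two axioms the inner expression is a function on a tensor product over \<open>B\<close>. That it
  is well defined needs only that multiplication associates with \<open>s(b)\<close> or \<open>t(b)\<close> as one of the factors.
\<close>

section \<open>Linear maps and multilinear quotients\<close>

abbreviation lin where "lin \<equiv> Vector_Spaces.linear"

declare vector_space_fscale [simp]

lemma lin_vs: "lin s t f \<Longrightarrow> vector_space s" "lin s t f \<Longrightarrow> vector_space t"
  by (simp_all add: linear_iff_expanded)

lemma lin_add: "lin s t f \<Longrightarrow> f (x + y) = f x + f y"
  and lin_scale: "lin s t f \<Longrightarrow> f (s r x) = t r (f x)"
  by (simp_all add: linear_iff_expanded)

lemma lin_sum: "lin s t f \<Longrightarrow> f (\<Sum>i\<in>I. g i) = (\<Sum>i\<in>I. f (g i))"
  using module_hom.sum[of s t f g I] by (simp add: Vector_Spaces.linear_def)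

lemma lin_comp: "lin s t f \<Longrightarrow> lin t u g \<Longrightarrow> lin s u (\<lambda>x. g (f x))"
  by (simp add: linear_iff_expanded)

lemma vector_space_mult [simp]: "vector_space ((*) :: 'k::field \<Rightarrow> 'k \<Rightarrow> 'k)"
  by unfold_locales (auto simp: algebra_simps)

lemma lin_ident: "vector_space s \<Longrightarrow> lin s s (\<lambda>x. x)"
  by (simp add: linear_iff_expanded)

lemma lin_scaleR: "lin s t f \<Longrightarrow> lin s t (\<lambda>x. t r (f x))"
  by (auto simp: linear_iff_expanded vector_space_def mult.commute)

lemma lin_scaleL: "lin s (*) f \<Longrightarrow> vector_space t \<Longrightarrow> lin s t (\<lambda>x. t (f x) v)"
  by (auto simp: linear_iff_expanded vector_space_def)

lemma lin_lin_ext: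
  assumes "vector_space t" "vector_space s" "\<And>p. lin s t (\<lambda>x. F x p)"
  shows "lin s t (\<lambda>x. lin_ext t (F x) u)"
proof -
  interpret vector_space t by fact
  show ?thesis
    unfolding linear_iff_expanded lin_ext_def
    using assms by (auto simp: linear_iff_expanded scale_right_distrib sum.distrib
        scale_sum_right mult.commute)
qed

lemma lin_ext_push:
  assumes "lin s t G"
  shows "G (lin_ext s F u) = lin_ext t (\<lambda>p. G (F p)) u"
  unfolding lin_ext_def using assms by (simp add: lin_sum lin_scale)

lemma lin_ext_swap:
  assumes "vector_space t"
  shows "lin_ext t (\<lambda>p. lin_ext t (\<lambda>q. F p q) v) u = lin_ext t (\<lambda>q. lin_ext t (\<lambda>p. F p q) u) v"
proof -
  interpret vector_space t by fact
  show ?thesis unfolding lin_ext_def scale_sum_right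
    by (subst sum.swap) (simp add: mult.commute)
qed

text \<open>Each generator in \<open>trilin_rels\<close> is killed by \<open>quot_map\<close>; read
  as equations, these generators are the six additivity and homogeneity laws.\<close>

lemma linear_tens3:
  assumes "vector_space sA" "vector_space sB" "vector_space sD"
  shows "lin sA fscale (\<lambda>x. tens3 sA sB sD x y z)"
   and "lin sB fscale (\<lambda>y. tens3 sA sB sD x y z)"
   and "lin sD fscale (\<lambda>z. tens3 sA sB sD x y z)"
proof -
  let ?G = "trilin_rels sA sB sD"
  interpret p: Vector_Spaces.linear fscale fscale "quot_map ?G" by (rule linear_quot_map)
  have *: "quot_map ?G g = 0" if "g \<in> ?G" for g
    unfolding quot_map_eq_0_iff using that by (rule module.span_base[OF module_iff_vector_space[THEN iffD2, OF vector_space_fscale]])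
  have "quot_map ?G (pt (x + x', y, z) - pt (x, y, z) - pt (x', y, z)) = 0" for x x' y z
    by (rule *) (unfold trilin_rels_def, fast)
  moreover have "quot_map ?G (pt (x, y + y', z) - pt (x, y, z) - pt (x, y', z)) = 0" for x y' y z
    by (rule *) (unfold trilin_rels_def, fast)
  moreover have "quot_map ?G (pt (x, y, z + z') - pt (x, y, z) - pt (x, y, z')) = 0" for x z' y z
    by (rule *) (unfold trilin_rels_def, fast)
  moreover have "quot_map ?G (pt (sA r x, y, z) - fscale r (pt (x, y, z))) = 0" for x r y z
    by (rule *) (unfold trilin_rels_def, fast)
  moreover have "quot_map ?G (pt (x, sB r y, z) - fscale r (pt (x, y, z))) = 0" for x r y z
    by (rule *) (unfold trilin_rels_def, fast)
  moreover have "quot_map ?G (pt (x, y, sD r z) - fscale r (pt (x, y, z))) = 0" for x r y z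
    by (rule *) (unfold trilin_rels_def, fast)
  ultimately
  show "lin sA fscale (\<lambda>x. tens3 sA sB sD x y z)"
   and "lin sB fscale (\<lambda>y. tens3 sA sB sD x y z)"
   and "lin sD fscale (\<lambda>z. tens3 sA sB sD x y z)"
    using assms
    by (simp_all add: linear_iff_expanded tens3_def p.diff p.add p.scale algebra_simps)
qed

text \<open>An element of the free space is the combination of points given by its own coefficients.
  This is what later reduces equality of linear maps to pure tensors.\<close>

lemma lin_ext_pt_self: "lin_ext fscale pt u = u"
proof -
  have "lin_ext fscale pt u = (\<Sum>x\<in>Poly_Mapping.keys u. Poly_Mapping.single x (Poly_Mapping.lookup u x))"
    unfolding lin_ext_def
    by (rule sum.cong) (auto intro!: poly_mapping_eqI simp: lookup_fscale lookup_single when_def)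
  also have "\<dots> = u"
    by (rule poly_mapping_eqI) (simp add: lookup_sum lookup_single when_def in_keys_iff)
  finally show ?thesis .
qed

text \<open>\<open>G\<close> may contain further relations, so that the laws also hold in the tensor
  product balanced over the base algebra. The relations range over the subspaces \<open>A\<close>
  and \<open>D\<close>, hence the membership conditions in place of global linearity.\<close>

lemma linear_quot_bilin:
  assumes G: "bilin_rels A sA D sC \<subseteq> G"
  shows "x \<in> A \<Longrightarrow> x' \<in> A \<Longrightarrow> y \<in> D \<Longrightarrow> quot_map G (pt (x + x', y)) = quot_map G (pt (x, y)) + quot_map G (pt (x', y))"
    and "x \<in> A \<Longrightarrow> y \<in> D \<Longrightarrow> y' \<in> D \<Longrightarrow> quot_map G (pt (x, y + y')) = quot_map G (pt (x, y)) + quot_map G (pt (x, y'))"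
    and "x \<in> A \<Longrightarrow> y \<in> D \<Longrightarrow> quot_map G (pt (sA r x, y)) = fscale r (quot_map G (pt (x, y)))"
    and "x \<in> A \<Longrightarrow> y \<in> D \<Longrightarrow> quot_map G (pt (x, sC r y)) = fscale r (quot_map G (pt (x, y)))"
proof -
  interpret p: Vector_Spaces.linear fscale fscale "quot_map G" by (rule linear_quot_map)
  have *: "quot_map G g = 0" if "g \<in> bilin_rels A sA D sC" for g
    unfolding quot_map_eq_0_iff using that G
    by (intro module.span_base[OF module_iff_vector_space[THEN iffD2, OF vector_space_fscale]]) auto
  show "quot_map G (pt (x + x', y)) = quot_map G (pt (x, y)) + quot_map G (pt (x', y))"
    if "x \<in> A" "x' \<in> A" "y \<in> D" for x x' y
  proof -
    have "quot_map G (pt (x + x', y) - pt (x, y) - pt (x', y)) = 0"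
      by (rule *) (use that in \<open>unfold bilin_rels_def, fast\<close>)
    then show ?thesis by (simp add: p.diff p.add algebra_simps)
  qed
  show "quot_map G (pt (x, y + y')) = quot_map G (pt (x, y)) + quot_map G (pt (x, y'))"
    if "x \<in> A" "y \<in> D" "y' \<in> D" for x y y'
  proof -
    have "quot_map G (pt (x, y + y') - pt (x, y) - pt (x, y')) = 0"
      by (rule *) (use that in \<open>unfold bilin_rels_def, fast\<close>)
    then show ?thesis by (simp add: p.diff p.add algebra_simps)
  qed
  show "quot_map G (pt (sA r x, y)) = fscale r (quot_map G (pt (x, y)))"
    if "x \<in> A" "y \<in> D" for r x y
  proof -
    have "quot_map G (pt (sA r x, y) - fscale r (pt (x, y))) = 0"
      by (rule *) (use that in \<open>unfold bilin_rels_def, fast\<close>)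
    then show ?thesis by (simp add: p.diff p.scale)
  qed
  show "quot_map G (pt (x, sC r y)) = fscale r (quot_map G (pt (x, y)))"
    if "x \<in> A" "y \<in> D" for r x y
  proof -
    have "quot_map G (pt (x, sC r y) - fscale r (pt (x, y))) = 0"
      by (rule *) (use that in \<open>unfold bilin_rels_def, fast\<close>)
    then show ?thesis by (simp add: p.diff p.scale)
  qed
qed

lemma sw3_eq: "sw3 H sc f = sw2 H sc (\<lambda>h1. sw2 H sc (f h1))"
  and sw4_eq: "sw4 H sc g = sw2 H sc (\<lambda>h1. sw3 H sc (g h1))"
  by (auto simp: sw3_def sw4_def)

section \<open>Sweedler sums in a Hopf algebra\<close>

context hopf_algebra
begin

abbreviation "S \<equiv> antip H"
abbreviation "\<epsilon> \<equiv> counit H"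
abbreviation "hs \<equiv> hsc H"
abbreviation "sw \<equiv> sw2 H"

lemma vs_h [simp]: "vector_space hs" ..

lemma lin_sw_arg:
  assumes "vector_space sc" "lin s hs g"
  shows "lin s sc (\<lambda>x. sw sc f (g x))"
  unfolding sw2_def using assms
  by (intro lin_comp[OF lin_comp[OF assms(2) comul_linear]] linear_lin_ext)

lemma lin_sw_body:
  assumes "vector_space sc" "vector_space s" "\<And>a b. lin s sc (\<lambda>x. f x a b)"
  shows "lin s sc (\<lambda>x. sw sc (\<lambda>a b. f x a b) h)"
  unfolding sw2_def using assms by (intro lin_lin_ext) auto

lemma sw_push:
  assumes "lin s t G"
  shows "G (sw s F h) = sw t (\<lambda>a b. G (F a b)) h"
  unfolding sw2_def by (subst lin_ext_push[OF assms]) (simp add: case_prod_beta')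

lemma sw_swap:
  assumes "vector_space sc"
  shows "sw sc (\<lambda>x y. sw sc (\<lambda>a b. F x y a b) g) h = sw sc (\<lambda>a b. sw sc (\<lambda>x y. F x y a b) h) g"
  unfolding sw2_def case_prod_beta' by (rule lin_ext_swap[OF assms])

text \<open>Used from left to right as a rewrite rule, this brings every sum whose legs are split from left
  to right into right-nested form, which makes differently bracketed sums equal.\<close>

lemma sw_assoc:
  assumes "\<And>b c. lin hs sc (\<lambda>a. f a b c)" "\<And>a c. lin hs sc (\<lambda>b. f a b c)" "\<And>a b. lin hs sc (\<lambda>c. f a b c)"
  shows "sw sc (\<lambda>x y. sw sc (\<lambda>x1 x2. f x1 x2 y) x) h = sw sc (\<lambda>x z. sw sc (\<lambda>y1 y2. f x y1 y2) z) h"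
proof -
  have vs: "vector_space sc" using assms(1) lin_vs by blast
  have L: "lin_ext sc (\<lambda>(x,y,z). f x y z) (tens3 hs hs hs a b c) = f a b c" for a b c
    by (rule lin_ext_tens3) (auto simp: bilin_def assms)
  note p = sw_push[OF linear_lin_ext[OF vs]]
  show ?thesis
    using arg_cong[OF coassoc[of h], of "lin_ext sc (\<lambda>(x,y,z). f x y z)"]
    by (simp add: p L)
qed

lemma bilinI: "(\<And>y. lin s u (\<lambda>x. f x y)) \<Longrightarrow> (\<And>x. lin t u (\<lambda>y. f x y)) \<Longrightarrow> bilin s t u f"
  by (simp add: bilin_def)

text \<open>A bilinear \<open>f\<close> factors through the tensor product, and there
  \<open>comul_mult\<close> computes the coproduct of \<open>h * g\<close>.\<close>

lemma sw_mult:
  assumes "\<And>y. lin hs sc (\<lambda>x. f x y)" "\<And>x. lin hs sc (\<lambda>y. f x y)"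
  shows "sw sc f (h * g) = sw sc (\<lambda>h1 h2. sw sc (\<lambda>g1 g2. f (h1 * g1) (h2 * g2)) g) h"
proof -
  have vs: "vector_space sc" using assms(1) lin_vs by blast
  note p = sw_push[OF linear_lin_ext[OF vs]]
  have "sw sc f (h * g) = lin_ext sc (\<lambda>(x, y). f x y) (comul H (h * g))" by (simp add: sw2_def)
  also have "\<dots> = sw sc (\<lambda>h1 h2. sw sc (\<lambda>g1 g2. f (h1 * g1) (h2 * g2)) g) h"
    by (simp add: comul_mult p lin_ext_tens2 bilinI assms)
  finally show ?thesis .
qed

lemma sw_one:
  assumes "\<And>y. lin hs sc (\<lambda>x. f x y)" "\<And>x. lin hs sc (\<lambda>y. f x y)"
  shows "sw sc f 1 = f 1 1"
  using lin_ext_tens2[of hs hs sc f 1 1] assms by (simp add: sw2_def comul_one bilinI)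

lemma sw_counit_left:
  assumes "lin hs sc f"
  shows "sw sc (\<lambda>x y. sc (\<epsilon> x) (f y)) h = f h"
  using arg_cong[OF counit_left[of h], of f] by (simp add: sw_push[OF assms] lin_scale[OF assms])

lemma sw_counit_right:
  assumes "lin hs sc f"
  shows "sw sc (\<lambda>x y. sc (\<epsilon> y) (f x)) h = f h"
  using arg_cong[OF counit_right[of h], of f] by (simp add: sw_push[OF assms] lin_scale[OF assms])

lemma sw_antip_left:
  assumes "lin hs sc K"
  shows "sw sc (\<lambda>x y. K (S x * y)) h = sc (\<epsilon> h) (K 1)"
  using arg_cong[OF antip_left[of h], of K] by (simp add: sw_push[OF assms] lin_scale[OF assms])

lemma sw_antip_right:
  assumes "lin hs sc K"
  shows "sw sc (\<lambda>x y. K (x * S y)) h = sc (\<epsilon> h) (K 1)"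
  using arg_cong[OF antip_right[of h], of K] by (simp add: sw_push[OF assms] lin_scale[OF assms])

lemma lin_S: "lin s hs f \<Longrightarrow> lin s hs (\<lambda>x. S (f x))"
  using lin_comp antip_linear by blast

lemma lin_eps: "lin s hs f \<Longrightarrow> lin s (*) (\<lambda>x. \<epsilon> (f x))"
  using lin_comp counit_linear by blast

lemma lin_hmult_left: "lin s hs f \<Longrightarrow> lin s hs (\<lambda>x. f x * g)"
  and lin_hmult_right: "lin s hs f \<Longrightarrow> lin s hs (\<lambda>x. g * f x)"
  by (auto simp: linear_iff_expanded algebra_simps scale_mult_left scale_mult_right)

lemmas lin_hopf = lin_ident lin_scaleR lin_scaleL lin_S lin_eps lin_hmult_left lin_hmult_right lin_sw_arg
  lin_sw_body vector_space_fscale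

text \<open>Rebracketing turns the two adjacent legs into the split of a single leg, where the
  antipode axiom applies; the counit it leaves is absorbed by the remaining leg. The second slot of
  \<open>K\<close> carries the rest of a longer sum.\<close>

lemma sw_antip_cancel_left:
  assumes "\<And>y. lin hs sc (\<lambda>x. K x y)" "\<And>x. lin hs sc (\<lambda>y. K x y)"
  shows "sw sc (\<lambda>a z. sw sc (\<lambda>b y. K (S a * b) y) z) h = K 1 h"
proof -
  have vs [simp]: "vector_space sc" using assms(1) lin_vs by blast
  have [simp]: "lin hs sc (\<lambda>x. K (f x) y)" if "lin hs hs f" for f y
    using lin_comp[OF that assms(1)] .
  show ?thesis
    apply (subst sw_assoc[symmetric])
       apply (simp_all add: lin_hopf assms) [3]
    apply (simp add: sw_antip_left[where K="\<lambda>t. K t _"] assms sw_counit_left)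
    done
qed

lemma sw_antip_cancel_right:
  assumes "\<And>y. lin hs sc (\<lambda>x. K x y)" "\<And>x. lin hs sc (\<lambda>y. K x y)"
  shows "sw sc (\<lambda>a z. sw sc (\<lambda>b y. K (a * S b) y) z) h = K 1 h"
proof -
  have vs [simp]: "vector_space sc" using assms(1) lin_vs by blast
  have [simp]: "lin hs sc (\<lambda>x. K (f x) y)" if "lin hs hs f" for f y
    using lin_comp[OF that assms(1)] .
  show ?thesis
    apply (subst sw_assoc[symmetric])
       apply (simp_all add: lin_hopf assms) [3]
    apply (simp add: sw_antip_right[where K="\<lambda>t. K t _"] assms sw_counit_left)
    done
qed

lemma sw_antip_cancel_right_end:
  assumes "\<And>y. lin hs sc (\<lambda>x. K x y)" "\<And>x. lin hs sc (\<lambda>y. K x y)"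
  shows "sw sc (\<lambda>y z. sw sc (\<lambda>a b. K y (a * S b)) z) h = K h 1"
  by (simp add: sw_antip_right[where K="\<lambda>t. K _ t"] sw_counit_right[where sc=sc] assms)

section \<open>The antipode as an antihomomorphism of algebras and of coalgebras\<close>

lemma antip_one: "S 1 = 1"
  using antip_right[of 1] by (subst (asm) sw_one) (simp_all add: lin_hopf counit_one)

lemma counit_antip: "\<epsilon> (S h) = \<epsilon> h"
proof -
  have "\<epsilon> (sw hs (\<lambda>h1 h2. S h1 * h2) h) = sw (*) (\<lambda>h1 h2. \<epsilon> h2 * \<epsilon> (S h1)) h"
    by (subst sw_push[OF counit_linear]) (simp add: counit_mult mult.commute)
  also have "\<dots> = \<epsilon> (S h)" by (rule sw_counit_right) (simp add: lin_hopf)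
  finally show ?thesis by (simp add: antip_left lin_scale[OF counit_linear] counit_one)
qed

text \<open>Uniqueness of convolution inverses: both sides are inverse to the multiplication map of
  \<open>H\<close>. The sum \<open>?E\<close> is the product of left inverse, multiplication and
  right inverse; cancelling from the right end gives \<open>S (h * g)\<close>, cancelling from the
  left end gives \<open>S g * S h\<close>.\<close>

lemma antip_mult: "S (h * g) = S g * S h"
proof -
  let ?E = "sw hs (\<lambda>h1 z. sw hs (\<lambda>h2 h3. sw hs (\<lambda>g1 y. sw hs (\<lambda>g2 g3.
    S (h1 * g1) * (h2 * (g2 * S g3) * S h3)) y) g) z) h"
  have "?E = sw hs (\<lambda>h1 z. sw hs (\<lambda>h2 h3. S (h1 * g) * (h2 * S h3)) z) h"
    by (subst sw_antip_cancel_right_end[where K="\<lambda>g1 t. S (_ * g1) * (_ * t * S _)"]) (simp_all add: lin_hopf)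
  also have "\<dots> = S (h * g)"
    by (subst sw_antip_cancel_right_end[where K="\<lambda>h1 t. S (h1 * g) * t"]) (simp_all add: lin_hopf)
  finally have 1: "?E = S (h * g)" .
  have "?E = sw hs (\<lambda>x h3. sw hs (\<lambda>h1 h2. sw hs (\<lambda>y g3. sw hs (\<lambda>g1 g2.
    S (h1 * g1) * (h2 * g2) * (S g3 * S h3)) y) g) x) h"
    by (simp add: sw_assoc lin_hopf mult.assoc)
  also have "\<dots> = sw hs (\<lambda>x h3. sw hs (\<lambda>y g3. sw hs (\<lambda>h1 h2. sw hs (\<lambda>g1 g2.
    S (h1 * g1) * (h2 * g2) * (S g3 * S h3)) y) x) g) h"
    by (subst sw_swap) (simp_all)
  also have "\<dots> = sw hs (\<lambda>x h3. sw hs (\<lambda>y g3. sw hs (\<lambda>h1 h2.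
    S h1 * h2 * (S g3 * S h3)) (x * y)) g) h"
    by (simp add: sw_mult lin_hopf)
  also have "\<dots> = sw hs (\<lambda>x h3. hs (\<epsilon> x) (sw hs (\<lambda>y g3. hs (\<epsilon> y) (S g3 * S h3)) g)) h"
    by (simp add: sw_antip_left[where K="\<lambda>t. t * (S _ * S _)"] lin_hopf counit_mult
      sw_push[OF lin_scaleR[OF lin_ident]])
  also have "\<dots> = S g * S h"
    by (simp add: sw_counit_left[where sc=hs] lin_hopf)
  finally show ?thesis using 1 by simp
qed

text \<open>The dual of the argument for products: the coproduct of \<open>S h\<close> and the
  flipped pair of antipodes are a left and a right convolution inverse of the comultiplication. In
  \<open>?E\<close> the former is split into \<open>x1\<close>, \<open>x2\<close>, the
  comultiplication contributes \<open>b\<close>, \<open>c\<close>, and the flipped pair contributes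
  \<open>S e\<close>, \<open>S d\<close>.\<close>

lemma sw_antip:
  assumes f: "\<And>y. lin hs sc (\<lambda>x. f x y)" "\<And>x. lin hs sc (\<lambda>y. f x y)"
  shows "sw sc f (S h) = sw sc (\<lambda>x y. f (S y) (S x)) h"
proof -
  have vs [simp]: "vector_space sc" using assms(1) lin_vs by blast
  have [simp]: "lin hs sc (\<lambda>x. f (g x) y)" if "lin hs hs g" for g y
    using lin_comp[OF that f(1)] .
  have [simp]: "lin hs sc (\<lambda>x. f y (g x))" if "lin hs hs g" for g y
    using lin_comp[OF that f(2)] .
  let ?E = "sw sc (\<lambda>a z. sw sc (\<lambda>b z. sw sc (\<lambda>c z. sw sc (\<lambda>d e.
    sw sc (\<lambda>x1 x2. f (x1 * (b * S e)) (x2 * (c * S d))) (S a)) z) z) z) h"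
  have "?E = sw sc (\<lambda>a z. sw sc (\<lambda>b e. sw sc (\<lambda>x1 x2. f (x1 * (b * S e)) x2) (S a)) z) h"
    by (subst sw_antip_cancel_right[where K="\<lambda>t e. sw sc (\<lambda>x1 x2. f (x1 * (_ * S e)) (x2 * t)) (S _)"])
      (simp_all add: lin_hopf)
  also have "\<dots> = sw sc f (S h)"
    by (subst sw_antip_cancel_right_end[where K="\<lambda>a t. sw sc (\<lambda>x1 x2. f (x1 * t) x2) (S a)"])
      (simp_all add: lin_hopf)
  finally have 1: "?E = sw sc f (S h)" .
  have "?E = sw sc (\<lambda>w z. sw sc (\<lambda>a y. sw sc (\<lambda>x1 x2. sw sc (\<lambda>b c. sw sc (\<lambda>d e.
    f (x1 * b * S e) (x2 * c * S d)) z) y) (S a)) w) h"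
    by (simp add: sw_assoc lin_hopf mult.assoc sw_swap[where g="S _"])
  also have "\<dots> = sw sc (\<lambda>w z. sw sc (\<lambda>a y. sw sc (\<lambda>x1 x2. sw sc (\<lambda>d e.
    f (x1 * S e) (x2 * S d)) z) (S a * y)) w) h"
    by (simp add: sw_mult lin_hopf)
  also have "\<dots> = sw sc (\<lambda>w z. sc (\<epsilon> w) (sw sc (\<lambda>d e. f (S e) (S d)) z)) h"
    by (simp add: sw_antip_left[where K="\<lambda>t. sw sc _ t"] lin_hopf sw_one sw_push[OF lin_scaleR[OF lin_ident]])
  also have "\<dots> = sw sc (\<lambda>d e. f (S e) (S d)) h"
    by (simp add: sw_counit_left[where sc=sc] lin_hopf)
  finally show ?thesis using 1 by simp
qed

text \<open>Two neighbouring legs are both split, and the split of \<open>v\<close> sits inside the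
  split of \<open>u\<close>. Exchanging the independent sums first puts each split next to the leg
  it refines, after which \<open>sw_assoc\<close> applies.\<close>

lemma sw_assoc_pair:
  assumes "\<And>b c d e. lin hs sc (\<lambda>a. f a b c d e)" "\<And>a c d e. lin hs sc (\<lambda>b. f a b c d e)"
    "\<And>a b d e. lin hs sc (\<lambda>c. f a b c d e)" "\<And>a b c e. lin hs sc (\<lambda>d. f a b c d e)"
    "\<And>a b c d. lin hs sc (\<lambda>e. f a b c d e)"
  shows "sw sc (\<lambda>u z. sw sc (\<lambda>v e. sw sc (\<lambda>a b. sw sc (\<lambda>c d. f a b c d e) v) u) z) h =
    sw sc (\<lambda>a z. sw sc (\<lambda>b z. sw sc (\<lambda>c z. sw sc (\<lambda>d e. f a b c d e) z) z) z) h"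
proof -
  have [simp]: "vector_space sc" using assms(1) lin_vs by blast
  show ?thesis
    by (simp add: sw_swap[where sc=sc and h="_ :: 'h" and F="\<lambda>v e a b. sw sc (\<lambda>c d. f a b c d e) v"])
       (simp add: sw_assoc lin_hopf assms)
qed

end

section \<open>Identities of the cocycle\<close>

locale cr_bialgebroid_setup = hopf_algebra H + assoc_cocycle_cross_product H C
  for H :: "('k::field, 'h::ring_1) hopf_data"
    and C :: "('k, 'h, 'b::{ring,monoid_mult}) cocycle_data" +
  assumes bij_antip: "bij (antip H)"
begin

abbreviation "bs \<equiv> bsc C"
abbreviation action (infixr "\<rhd>" 72) where "h \<rhd> b \<equiv> act C h b"
abbreviation "\<sigma> \<equiv> coc C"
abbreviation "\<tau> \<equiv> cocinv C"
definition "Si = inv (antip H)"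

lemma Si_S [simp]: "Si (S h) = h"
  and S_Si [simp]: "S (Si h) = h"
  using bij_antip by (auto simp: Si_def bij_def surj_f_inv_f)

lemma linear_Si: "lin hs hs Si"
proof -
  have "Si (x + y) = Si x + Si y" for x y
    by (rule injD[OF bij_is_inj[OF bij_antip]]) (simp add: lin_add[OF antip_linear])
  moreover have "Si (hs r x) = hs r (Si x)" for r x
    by (rule injD[OF bij_is_inj[OF bij_antip]]) (simp add: lin_scale[OF antip_linear])
  ultimately show ?thesis by (simp add: linear_iff_expanded)
qed

lemma lin_Si: "lin s hs f \<Longrightarrow> lin s hs (\<lambda>x. Si (f x))"
  using lin_comp linear_Si by blast

lemma Si_mult: "Si (h * g) = Si g * Si h"
  by (rule injD[OF bij_is_inj[OF bij_antip]]) (simp add: antip_mult)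

lemma Si_one: "Si 1 = 1"
  by (rule injD[OF bij_is_inj[OF bij_antip]]) (simp add: antip_one)

lemma counit_Si: "\<epsilon> (Si h) = \<epsilon> h"
  using counit_antip[of "Si h"] by simp

text \<open>This is \<open>sw_antip\<close> at \<open>Si h\<close>, for the function
  \<open>f\<close> composed with \<open>Si\<close> and with its arguments exchanged.\<close>

lemma sw_Si:
  assumes f: "\<And>y. lin hs sc (\<lambda>x. f x y)" "\<And>x. lin hs sc (\<lambda>y. f x y)"
  shows "sw sc f (Si h) = sw sc (\<lambda>x y. f (Si y) (Si x)) h"
proof -
  have [simp]: "lin hs sc (\<lambda>x. f (g x) y)" if "lin hs hs g" for g y
    using lin_comp[OF that f(1)] .
  have [simp]: "lin hs sc (\<lambda>x. f y (g x))" if "lin hs hs g" for g y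
    using lin_comp[OF that f(2)] .
  have "sw sc (\<lambda>x y. f (Si y) (Si x)) (S (Si h)) = sw sc f (Si h)"
    by (subst sw_antip) (simp_all add: linear_Si)
  then show ?thesis by simp
qed

lemma vs_b [simp]: "vector_space bs" by unfold_locales

lemma lin_act_left: "lin s hs f \<Longrightarrow> lin s bs (\<lambda>x. f x \<rhd> b)"
  and lin_act_right: "lin s bs f' \<Longrightarrow> lin s bs (\<lambda>x. h \<rhd> f' x)"
  and lin_coc_left: "lin s hs f \<Longrightarrow> lin s bs (\<lambda>x. \<sigma> (f x) g)"
  and lin_coc_right: "lin s hs f \<Longrightarrow> lin s bs (\<lambda>x. \<sigma> g (f x))"
  and lin_cocinv_left: "lin s hs f \<Longrightarrow> lin s bs (\<lambda>x. \<tau> (f x) g)"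
  and lin_cocinv_right: "lin s hs f \<Longrightarrow> lin s bs (\<lambda>x. \<tau> g (f x))"
  using act_bilin coc_bilin cocinv_bilin by (auto simp: bilin_def intro: lin_comp)

lemma lin_bmult_left: "lin s bs f' \<Longrightarrow> lin s bs (\<lambda>x. f' x * b)"
  and lin_bmult_right: "lin s bs f' \<Longrightarrow> lin s bs (\<lambda>x. b * f' x)"
  by (auto simp: linear_iff_expanded algebra_simps B.scale_mult_left B.scale_mult_right)

abbreviation "ct \<equiv> cr_tens H C"

lemma lin_ct1: "lin s bs f \<Longrightarrow> lin s fscale (\<lambda>x. ct (f x) c h)"
  and lin_ct2: "lin s bs f \<Longrightarrow> lin s fscale (\<lambda>x. ct c (f x) h)"
  and lin_ct3: "lin s hs f' \<Longrightarrow> lin s fscale (\<lambda>x. ct c d (f' x))"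
  unfolding cr_tens_def by (rule lin_comp, assumption, rule linear_tens3, simp_all)+

lemmas lin_intros = lin_hopf lin_scaleR[where t=bs] lin_scaleR[where t=fscale] lin_scaleL[where t=bs] lin_scaleL[where t=fscale] lin_Si lin_act_left lin_act_right lin_coc_left lin_coc_right lin_cocinv_left lin_cocinv_right
  lin_bmult_left lin_bmult_right lin_ct1 lin_ct2 lin_ct3

lemmas sw_bmult_left = sw_push[OF lin_bmult_left[OF lin_ident[OF vs_b]]]
lemmas sw_bmult_right = sw_push[OF lin_bmult_right[OF lin_ident[OF vs_b]]]
lemmas sw_act_right = sw_push[OF lin_act_right[OF lin_ident[OF vs_b]]]
lemmas sw_ct1 = sw_push[OF lin_ct1[OF lin_ident[OF vs_b]]]
lemmas sw_ct2 = sw_push[OF lin_ct2[OF lin_ident[OF vs_b]]]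
lemmas sw_ct3 = sw_push[OF lin_ct3[OF lin_ident[OF vs_h]]]

lemmas scale_bmult_left = lin_scale[OF lin_bmult_left[OF lin_ident[OF vs_b]]]
lemmas scale_bmult_right = lin_scale[OF lin_bmult_right[OF lin_ident[OF vs_b]]]
lemmas scale_act_right = lin_scale[OF lin_act_right[OF lin_ident[OF vs_b]]]
lemmas scale_act_left = lin_scale[OF lin_act_left[OF lin_ident[OF vs_h]]]
lemmas scale_ct1 = lin_scale[OF lin_ct1[OF lin_ident[OF vs_b]]]
lemmas scale_ct2 = lin_scale[OF lin_ct2[OF lin_ident[OF vs_b]]]
lemmas scale_ct3 = lin_scale[OF lin_ct3[OF lin_ident[OF vs_h]]]
lemmas sw_scale = sw_push[OF lin_scaleR[OF lin_ident]]

lemmas sw_pushes = sw_bmult_left sw_bmult_right sw_act_right sw_ct1 sw_ct2 sw_ct3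
lemmas scale_pushes = scale_bmult_left scale_bmult_right scale_act_right scale_act_left scale_ct1 scale_ct2 scale_ct3

text \<open>Stated without the argument, so that they also rewrite eta-contracted inner sums.\<close>

lemma counits:
  "lin hs bs f \<Longrightarrow> sw bs (\<lambda>x y. bs (\<epsilon> x) (f y)) = f"
  "lin hs bs f \<Longrightarrow> sw bs (\<lambda>x y. bs (\<epsilon> y) (f x)) = f"
  "lin hs fscale f' \<Longrightarrow> sw fscale (\<lambda>x y. fscale (\<epsilon> x) (f' y)) = f'"
  "lin hs fscale f' \<Longrightarrow> sw fscale (\<lambda>x y. fscale (\<epsilon> y) (f' x)) = f'"
  by (simp_all add: fun_eq_iff sw_counit_left sw_counit_right)

lemma pull_scale:
  "sw bs (\<lambda>x y. bs r (F x y)) = (\<lambda>h. bs r (sw bs F h))"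
  "sw fscale (\<lambda>x y. fscale r (F' x y)) = (\<lambda>h. fscale r (sw fscale F' h))"
  by (simp_all add: sw_scale)

section \<open>Convolution algebras of maps from H \<otimes> H and H \<otimes> H \<otimes> H to
  B\<close>

definition conv2 where
  "conv2 u v h g = sw bs (\<lambda>h1 h2. sw bs (\<lambda>g1 g2. u h1 g1 * v h2 g2) g) h"

definition conv3 where
  "conv3 u v h g f = sw bs (\<lambda>h1 h2. sw bs (\<lambda>g1 g2. sw bs (\<lambda>f1 f2. u h1 g1 f1 * v h2 g2 f2) f) g) h"

definition bil where "bil u \<longleftrightarrow> (\<forall>g. lin hs bs (\<lambda>h. u h g)) \<and> (\<forall>h. lin hs bs (\<lambda>g. u h g))"
definition tril where "tril u \<longleftrightarrow> (\<forall>g f. lin hs bs (\<lambda>h. u h g f)) \<and> (\<forall>h f. lin hs bs (\<lambda>g. u h g f))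
  \<and> (\<forall>h g. lin hs bs (\<lambda>f. u h g f))"

lemma conv2_assoc:
  assumes "bil u" "bil v" "bil w"
  shows "conv2 (conv2 u v) w = conv2 u (conv2 v w)"
proof (intro ext)
  fix h g
  show "conv2 (conv2 u v) w h g = conv2 u (conv2 v w) h g"
    using assms unfolding bil_def conv2_def
    apply (simp add: sw_pushes mult.assoc)
    apply (simp add: sw_swap[where h=g])
    apply (simp add: sw_assoc lin_intros)
    done
qed

lemma conv3_assoc:
  assumes "tril u" "tril v" "tril w"
  shows "conv3 (conv3 u v) w = conv3 u (conv3 v w)"
proof (intro ext)
  fix h g f
  show "conv3 (conv3 u v) w h g f = conv3 u (conv3 v w) h g f"
    using assms unfolding tril_def conv3_def
    apply (simp add: sw_pushes mult.assoc)
    apply (simp add: sw_swap[where h=f])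
    apply (simp add: sw_swap[where h=g])
    apply (simp add: sw_assoc lin_intros)
    done
qed

definition "one2 h g = bs (\<epsilon> h * \<epsilon> g) 1"
definition "one3 h g f = bs (\<epsilon> h * \<epsilon> g * \<epsilon> f) 1"

lemma conv2_one:
  assumes "bil u"
  shows "conv2 one2 u = u" "conv2 u one2 = u"
  using assms unfolding one2_def conv2_def bil_def
  by (simp_all add: scale_pushes counits lin_intros pull_scale flip: B.scale_scale)

lemma bil_rules: "bil \<sigma>" "bil \<tau>" "bil (\<lambda>h g. (h * g) \<rhd> b)"
  by (simp_all add: bil_def lin_intros)

lemma conv2_inverse: "conv2 \<sigma> \<tau> = one2" "conv2 \<tau> \<sigma> = one2"
  by (intro ext, simp add: conv2_def one2_def coc_cocinv cocinv_coc)+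

lemma bil_conv2: "bil u \<Longrightarrow> bil v \<Longrightarrow> bil (conv2 u v)"
  by (simp add: bil_def conv2_def lin_intros)

lemma tril_conv3: "tril u \<Longrightarrow> tril v \<Longrightarrow> tril (conv3 u v)"
  by (simp add: tril_def conv3_def lin_intros)

text \<open>The twisted action axiom and the module axiom \<open>act_act\<close> compute
  \<open>h \<rhd> (g \<rhd> b)\<close> in two ways; hence conjugation by \<open>\<sigma>\<close>
  fixes the map sending h, g to \<open>(h * g) \<rhd> b\<close>.\<close>

lemma conv2_twisted: "conv2 \<sigma> (conv2 (\<lambda>h g. (h * g) \<rhd> b) \<tau>) = (\<lambda>h g. (h * g) \<rhd> b)"
proof (intro ext)
  fix h g
  have "conv2 \<sigma> (conv2 (\<lambda>h g. (h * g) \<rhd> b) \<tau>) h g = h \<rhd> (g \<rhd> b)"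
    unfolding act_act_twisted sw3_def conv2_def
    by (simp add: sw_pushes sw_swap[where h=g] mult.assoc)
  then show "conv2 \<sigma> (conv2 (\<lambda>h g. (h * g) \<rhd> b) \<tau>) h g = (h * g) \<rhd> b" by (simp add: act_act)
qed

text \<open>Multiplying \<open>conv2_twisted\<close> by \<open>\<sigma>\<close> on the right,
  respectively by \<open>\<tau>\<close> on the left, cancels one of the two conjugating
  factors.\<close>

lemma conv2_commute:
  "conv2 (\<lambda>h g. (h * g) \<rhd> b) \<sigma> = conv2 \<sigma> (\<lambda>h g. (h * g) \<rhd> b)" (is "conv2 ?P _ = _")
  "conv2 \<tau> (\<lambda>h g. (h * g) \<rhd> b) = conv2 (\<lambda>h g. (h * g) \<rhd> b) \<tau>"
proof -
  note r = conv2_assoc bil_conv2 bil_rules conv2_inverse conv2_one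
  have "conv2 ?P \<sigma> = conv2 (conv2 \<sigma> (conv2 ?P \<tau>)) \<sigma>" by (simp add: conv2_twisted)
  also have "\<dots> = conv2 \<sigma> ?P" by (simp add: r)
  finally show "conv2 ?P \<sigma> = conv2 \<sigma> ?P" .
  have "conv2 \<tau> ?P = conv2 \<tau> (conv2 \<sigma> (conv2 ?P \<tau>))" by (simp add: conv2_twisted)
  also have "\<dots> = conv2 ?P \<tau>" by (simp add: r flip: conv2_assoc)
  finally show "conv2 \<tau> ?P = conv2 ?P \<tau>" .
qed

lemma conv3_one:
  assumes "tril u"
  shows "conv3 one3 u = u" "conv3 u one3 = u"
  using assms unfolding one3_def conv3_def tril_def
  by (simp_all add: scale_pushes counits lin_intros pull_scale flip: B.scale_scale)

lemma tril_rules: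
  "tril (\<lambda>h g f. h \<rhd> \<sigma> g f)" "tril (\<lambda>h g f. h \<rhd> \<tau> g f)"
  "tril (\<lambda>h g f. bs (\<epsilon> f) (\<sigma> h g))" "tril (\<lambda>h g f. bs (\<epsilon> f) (\<tau> h g))"
  "tril (\<lambda>h g f. \<sigma> h (g * f))" "tril (\<lambda>h g f. \<tau> h (g * f))"
  "tril (\<lambda>h g f. \<sigma> (h * g) f)" "tril (\<lambda>h g f. \<tau> (h * g) f)"
  by (simp_all add: tril_def lin_intros)

text \<open>The inverses for solving the cocycle condition: a left inverse for the first factor of
  each side and a right inverse for the second factor of each side.\<close>

lemma conv3_inverse:
  "conv3 (\<lambda>h g f. h \<rhd> \<tau> g f) (\<lambda>h g f. h \<rhd> \<sigma> g f) = one3"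
  "conv3 (\<lambda>h g f. bs (\<epsilon> f) (\<tau> h g)) (\<lambda>h g f. bs (\<epsilon> f) (\<sigma> h g)) = one3"
  "conv3 (\<lambda>h g f. \<sigma> h (g * f)) (\<lambda>h g f. \<tau> h (g * f)) = one3"
  "conv3 (\<lambda>h g f. \<sigma> (h * g) f) (\<lambda>h g f. \<tau> (h * g) f) = one3"
proof -
  show "conv3 (\<lambda>h g f. h \<rhd> \<tau> g f) (\<lambda>h g f. h \<rhd> \<sigma> g f) = one3"
  proof (intro ext)
    fix h g f
    \<comment> \<open>By the measuring property, the sum over the legs of \<open>h\<close> is the
      action of \<open>h\<close> on a product, so \<open>h\<close> can be taken outside.\<close>
    have "conv3 (\<lambda>h g f. h \<rhd> \<tau> g f) (\<lambda>h g f. h \<rhd> \<sigma> g f) h g f =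
      h \<rhd> sw bs (\<lambda>g1 g2. sw bs (\<lambda>f1 f2. \<tau> g1 f1 * \<sigma> g2 f2) f) g"
      unfolding conv3_def
      by (simp add: sw_swap[where h=h] act_mult[symmetric] sw_pushes)
    then show "conv3 (\<lambda>h g f. h \<rhd> \<tau> g f) (\<lambda>h g f. h \<rhd> \<sigma> g f) h g f = one3 h g f"
      by (simp add: cocinv_coc scale_pushes act_on_one one3_def mult_ac)
  qed
  show "conv3 (\<lambda>h g f. bs (\<epsilon> f) (\<tau> h g)) (\<lambda>h g f. bs (\<epsilon> f) (\<sigma> h g)) = one3"
  proof (intro ext)
    fix h g f
    have "conv3 (\<lambda>h g f. bs (\<epsilon> f) (\<tau> h g)) (\<lambda>h g f. bs (\<epsilon> f) (\<sigma> h g)) h g f =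
      bs (\<epsilon> f) (sw bs (\<lambda>g1 g2. sw bs (\<lambda>f1 f2. \<tau> g1 f1 * \<sigma> g2 f2) g) h)"
      unfolding conv3_def
      by (simp add: scale_pushes counits lin_intros pull_scale flip: B.scale_scale)
    then show "conv3 (\<lambda>h g f. bs (\<epsilon> f) (\<tau> h g)) (\<lambda>h g f. bs (\<epsilon> f) (\<sigma> h g)) h g f = one3 h g f"
      by (simp add: cocinv_coc scale_pushes one3_def mult_ac)
  qed
  show "conv3 (\<lambda>h g f. \<sigma> h (g * f)) (\<lambda>h g f. \<tau> h (g * f)) = one3"
  proof (intro ext)
    fix h g f
    show "conv3 (\<lambda>h g f. \<sigma> h (g * f)) (\<lambda>h g f. \<tau> h (g * f)) h g f = one3 h g f"
      using coc_cocinv[where h=h and g="g * f"] by (simp add: conv3_def one3_def sw_mult lin_intros counit_mult mult_ac)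
  qed
  show "conv3 (\<lambda>h g f. \<sigma> (h * g) f) (\<lambda>h g f. \<tau> (h * g) f) = one3"
  proof (intro ext)
    fix h g f
    show "conv3 (\<lambda>h g f. \<sigma> (h * g) f) (\<lambda>h g f. \<tau> (h * g) f) h g f = one3 h g f"
      using coc_cocinv[where h="h * g" and g=f] by (simp add: conv3_def one3_def sw_mult lin_intros counit_mult mult_ac)
  qed
qed

text \<open>The factor \<open>\<sigma> h g\<close> has no third argument. A counit in
  \<open>f\<close> supplies it, and the cocycle condition becomes an equation between two products
  in the threefold convolution algebra.\<close>

lemma conv3_cocycle:
  "conv3 (\<lambda>h g f. h \<rhd> \<sigma> g f) (\<lambda>h g f. \<sigma> h (g * f)) =
   conv3 (\<lambda>h g f. bs (\<epsilon> f) (\<sigma> h g)) (\<lambda>h g f. \<sigma> (h * g) f)"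
  unfolding conv3_def cocycle
  by (intro ext) (simp add: scale_pushes counits lin_intros)

text \<open>From \<open>U R = Q T\<close>, with \<open>U'\<close> a left inverse of \<open>U\<close>
  and \<open>T'\<close> a right inverse of \<open>T\<close>, it follows that
  \<open>U' Q = R T'\<close>.\<close>

lemma cocycle_inv_right:
  "conv3 (\<lambda>h g f. h \<rhd> \<tau> g f) (\<lambda>h g f. bs (\<epsilon> f) (\<sigma> h g)) =
   conv3 (\<lambda>h g f. \<sigma> h (g * f)) (\<lambda>h g f. \<tau> (h * g) f)" (is "conv3 ?U' ?Q = conv3 ?R ?T'")
proof -
  let ?T = "\<lambda>h g f. \<sigma> (h * g) f" and ?U = "\<lambda>h g f. h \<rhd> \<sigma> g f"
  have "conv3 ?U' ?Q = conv3 ?U' (conv3 (conv3 ?Q ?T) ?T')"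
    by (simp add: conv3_assoc tril_rules conv3_inverse conv3_one)
  also have "\<dots> = conv3 (conv3 ?U' ?U) (conv3 ?R ?T')"
    unfolding conv3_cocycle[symmetric] by (simp add: conv3_assoc tril_rules tril_conv3)
  finally show ?thesis by (simp add: conv3_inverse conv3_one tril_conv3 tril_rules)
qed

text \<open>Dually, a left inverse \<open>Q'\<close> of \<open>Q\<close> and a right inverse
  \<open>R'\<close> of \<open>R\<close> turn \<open>U R = Q T\<close> into
  \<open>Q' U = T R'\<close>.\<close>

lemma cocycle_inv_left:
  "conv3 (\<lambda>h g f. bs (\<epsilon> f) (\<tau> h g)) (\<lambda>h g f. h \<rhd> \<sigma> g f) =
   conv3 (\<lambda>h g f. \<sigma> (h * g) f) (\<lambda>h g f. \<tau> h (g * f))" (is "conv3 ?Q' ?U = conv3 ?T ?R'")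
proof -
  let ?R = "\<lambda>h g f. \<sigma> h (g * f)" and ?Q = "\<lambda>h g f. bs (\<epsilon> f) (\<sigma> h g)"
  have "conv3 ?Q' ?U = conv3 ?Q' (conv3 (conv3 ?U ?R) ?R')"
    by (simp add: conv3_assoc tril_rules conv3_inverse conv3_one)
  also have "\<dots> = conv3 (conv3 ?Q' ?Q) (conv3 ?T ?R')"
    unfolding conv3_cocycle by (simp add: conv3_assoc tril_rules tril_conv3)
  finally show ?thesis by (simp add: conv3_inverse conv3_one tril_conv3 tril_rules)
qed

lemma sw_cocycle_inv_right:
  "sw bs (\<lambda>h1 h2. sw bs (\<lambda>g1 g2. (h1 \<rhd> \<tau> g1 f) * \<sigma> h2 g2) g) h =
   sw bs (\<lambda>h1 h2. sw bs (\<lambda>g1 g2. sw bs (\<lambda>f1 f2. \<sigma> h1 (g1 * f1) * \<tau> (h2 * g2) f2) f) g) h"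
  using cocycle_inv_right[THEN fun_cong, THEN fun_cong, THEN fun_cong, of h g f]
  by (simp add: conv3_def scale_pushes counits lin_intros)

lemma sw_cocycle_inv_left:
  "sw bs (\<lambda>h1 h2. sw bs (\<lambda>g1 g2. \<tau> h1 g1 * (h2 \<rhd> \<sigma> g2 f)) g) h =
   sw bs (\<lambda>h1 h2. sw bs (\<lambda>g1 g2. sw bs (\<lambda>f1 f2. \<sigma> (h1 * g1) f1 * \<tau> h2 (g2 * f2)) f) g) h"
  using cocycle_inv_left[THEN fun_cong, THEN fun_cong, THEN fun_cong, of h g f]
  by (simp add: conv3_def scale_pushes counits lin_intros)

section \<open>Cancellation of cocycle coefficients along the antipode\<close>

abbreviation "sb \<equiv> sw bs"
abbreviation "sf \<equiv> sw fscale"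

lemma cocinv_one_left: "\<tau> 1 h = bs (\<epsilon> h) 1"
  using coc_cocinv[where h=1 and g=h]
  by (simp add: sw_one lin_intros coc_one_left counit_one scale_pushes counits)

lemma cocinv_one_right: "\<tau> h 1 = bs (\<epsilon> h) 1"
  using coc_cocinv[where h=h and g=1]
  by (simp add: sw_one lin_intros coc_one_right counit_one scale_pushes counits)

text \<open>After \<open>cocycle_inv_right\<close> at \<open>S c\<close>, \<open>S (S b)\<close>,
  \<open>S a\<close>, the first argument of \<open>\<tau>\<close> is \<open>S (S b2 * c1)\<close>
  with adjacent legs, so it becomes 1. Then the second argument of \<open>\<sigma>\<close> is
  \<open>S (a * S b)\<close>, again with adjacent legs, and only counits are left.\<close>

lemma act_cocinv_coc_cancel:
  "sb (\<lambda>h1 z. sb (\<lambda>h2 z. sb (\<lambda>h3 z. sb (\<lambda>h4 h5.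
     (S h5 \<rhd> \<tau> (S (S h2)) (S h1)) * \<sigma> (S h4) (S (S h3))) z) z) z) h = bs (\<epsilon> h) 1" (is "?L = _")
proof -
  have 1: "sb (\<lambda>b1 b2. sb (\<lambda>c1 c2. (S c2 \<rhd> \<tau> (S (S b1)) (S a)) * \<sigma> (S c1) (S (S b2))) c) b =
    sb (\<lambda>a1 a2. sb (\<lambda>b1 b2. sb (\<lambda>c1 c2.
      \<sigma> (S c2) (S (S b1) * S a2) * \<tau> (S c1 * S (S b2)) (S a1)) c) b) a" for a b c
    using sw_cocycle_inv_right[where h="S c" and g="S (S b)" and f="S a"]
    by (simp add: sw_antip lin_intros sw_swap[where h=c] sw_swap[where h=b and g=a])
  have 2: "sb (\<lambda>b c. sb (\<lambda>b1 b2. sb (\<lambda>c1 c2.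
      \<sigma> (S c2) (S (S b1) * S a2) * \<tau> (S c1 * S (S b2)) (S a1)) c) b) z =
     bs (\<epsilon> a1) (sb (\<lambda>b c. \<sigma> (S c) (S (S b) * S a2)) z)" for a1 a2 z
    apply (simp add: sw_assoc lin_intros antip_mult[symmetric])
    apply (subst sw_antip_cancel_left[where K="\<lambda>t c. \<sigma> (S c) (S (_ * S _)) * \<tau> (S t) (S _)"])
    apply (simp_all add: lin_intros antip_one cocinv_one_left counit_antip scale_pushes sw_scale[OF vs_b])
    done
  have "?L = sb (\<lambda>a z. sb (\<lambda>b c. sb (\<lambda>b1 b2. sb (\<lambda>c1 c2.
      (S c2 \<rhd> \<tau> (S (S b1)) (S a)) * \<sigma> (S c1) (S (S b2))) c) b) z) h"
    by (simp add: sw_assoc lin_intros)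
  also have "\<dots> = sb (\<lambda>a z. sb (\<lambda>a1 a2. sb (\<lambda>b c. sb (\<lambda>b1 b2. sb (\<lambda>c1 c2.
      \<sigma> (S c2) (S (S b1) * S a2) * \<tau> (S c1 * S (S b2)) (S a1)) c) b) z) a) h"
    unfolding 1 by (subst sw_swap) simp_all
  also have "\<dots> = sb (\<lambda>a z. sb (\<lambda>b c. \<sigma> (S c) (S (a * S b))) z) h"
    unfolding 2 by (simp add: counits lin_intros antip_mult)
  also have "\<dots> = bs (\<epsilon> h) 1"
    by (subst sw_antip_cancel_right[where K="\<lambda>t c. \<sigma> (S c) (S t)"])
      (simp_all add: lin_intros antip_one coc_one_right counit_antip)
  finally show ?thesis .
qed

text \<open>After \<open>cocycle_inv_left\<close> at \<open>S a\<close>, \<open>b\<close>,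
  \<open>S c\<close>, the adjacent legs in \<open>S a2 * b1\<close> cancel and trivialise
  \<open>\<sigma>\<close>; this brings the legs in \<open>b2 * S c1\<close> together, and their
  cancellation trivialises \<open>\<tau>\<close>.\<close>

lemma cocinv_act_coc_cancel:
  "sb (\<lambda>h1 z. sb (\<lambda>h2 z. sb (\<lambda>h3 z. sb (\<lambda>h4 h5.
     \<tau> (S h2) h3 * (S h1 \<rhd> \<sigma> h4 (S h5))) z) z) z) h = bs (\<epsilon> h) 1" (is "?L = _")
proof -
  have 1: "sb (\<lambda>a1 a2. sb (\<lambda>b1 b2. \<tau> (S a2) b1 * (S a1 \<rhd> \<sigma> b2 (S c))) b) a =
    sb (\<lambda>a1 a2. sb (\<lambda>b1 b2. sb (\<lambda>c1 c2. \<sigma> (S a2 * b1) (S c2) * \<tau> (S a1) (b2 * S c1)) c) b) a" for a b c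
    using sw_cocycle_inv_left[where h="S a" and g=b and f="S c"]
    by (simp add: sw_antip lin_intros)
  have "?L = sb (\<lambda>a z. sb (\<lambda>b c. sb (\<lambda>a1 a2. sb (\<lambda>b1 b2. \<tau> (S a2) b1 * (S a1 \<rhd> \<sigma> b2 (S c))) b) a) z) h"
    by (subst sw_swap) (simp_all add: sw_assoc lin_intros)
  also have "\<dots> = sb (\<lambda>a z. sb (\<lambda>a1 a2. sb (\<lambda>b c. sb (\<lambda>b1 b2. sb (\<lambda>c1 c2.
      \<sigma> (S a2 * b1) (S c2) * \<tau> (S a1) (b2 * S c1)) c) b) z) a) h"
    unfolding 1 by (subst sw_swap) simp_all
  also have "\<dots> = sb (\<lambda>a1 z. sb (\<lambda>a2 z. sb (\<lambda>b1 z. sb (\<lambda>b2 z. sb (\<lambda>c1 c2.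
      \<sigma> (S a2 * b1) (S c2) * \<tau> (S a1) (b2 * S c1)) z) z) z) z) h"
    by (simp add: sw_assoc lin_intros)
  also have "\<dots> = sb (\<lambda>a1 z. sb (\<lambda>b2 z. sb (\<lambda>c1 c2.
      \<sigma> 1 (S c2) * \<tau> (S a1) (b2 * S c1)) z) z) h"
    by (subst sw_antip_cancel_left[where K="\<lambda>t z. sb (\<lambda>b2 z. sb (\<lambda>c1 c2.
      \<sigma> t (S c2) * \<tau> (S _) (b2 * S c1)) z) z"]) (simp_all add: lin_intros)
  also have "\<dots> = bs (\<epsilon> h) 1"
    by (simp add: coc_one_left scale_pushes counit_antip counits lin_intros)
      (subst sw_antip_cancel_right_end[where K="\<lambda>a t. \<tau> (S a) t"], simp_all add: lin_intros cocinv_one_right counit_antip)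
  finally show ?thesis .
qed

text \<open>This is the coefficient produced by applying the antipode and then its inverse.
  Commuting the action on \<open>b\<close> past \<open>\<sigma>\<close> brings the two legs acting
  on \<open>b\<close> next to each other, where they cancel; \<open>act_cocinv_coc_cancel\<close>
  disposes of the rest.\<close>

lemma anti_inv_anti_coefficient:
  "sb (\<lambda>h1 z. sb (\<lambda>h2 z. sb (\<lambda>h3 z. sb (\<lambda>h4 z. sb (\<lambda>h5 h6.
     (S h6 \<rhd> (\<tau> (S (S h2)) (S h1) * (S (S h3) \<rhd> b))) * \<sigma> (S h5) (S (S h4))) z) z) z) z) h = bs (\<epsilon> h) b"
  (is "?L = _")
proof -
  have 1: "sb (\<lambda>u1 u2. sb (\<lambda>v1 v2. ((S v2 * S (S u1)) \<rhd> b) * \<sigma> (S v1) (S (S u2))) v) u =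
    sb (\<lambda>u1 u2. sb (\<lambda>v1 v2. \<sigma> (S v2) (S (S u1)) * ((S v1 * S (S u2)) \<rhd> b)) v) u" for u v
    using conv2_commute(1)[of b, THEN fun_cong, THEN fun_cong, of "S v" "S (S u)"]
    by (simp add: conv2_def sw_antip lin_intros sw_swap[where h=v])
  have "?L = sb (\<lambda>h1 z. sb (\<lambda>h2 z. sb (\<lambda>u z. sb (\<lambda>v h7. sb (\<lambda>u1 u2. sb (\<lambda>v1 v2.
      (S h7 \<rhd> \<tau> (S (S h2)) (S h1)) * (((S v2 * S (S u1)) \<rhd> b) * \<sigma> (S v1) (S (S u2)))) v) u) z) z) z) h"
    by (simp add: sw_assoc sw_assoc_pair lin_intros act_mult sw_antip act_act sw_pushes mult.assoc)
  also have "\<dots> = sb (\<lambda>h1 z. sb (\<lambda>h2 z. sb (\<lambda>u z. sb (\<lambda>v h7. sb (\<lambda>u1 u2. sb (\<lambda>v1 v2.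
      (S h7 \<rhd> \<tau> (S (S h2)) (S h1)) * (\<sigma> (S v2) (S (S u1)) * (S (S u2 * v1) \<rhd> b))) v) u) z) z) z) h"
    unfolding sw_bmult_right[symmetric] 1 antip_mult ..
  also have "\<dots> = sb (\<lambda>h1 z. sb (\<lambda>h2 z. sb (\<lambda>u1 z. sb (\<lambda>u2 z. sb (\<lambda>v1 z. sb (\<lambda>v2 h7.
      (S h7 \<rhd> \<tau> (S (S h2)) (S h1)) * (\<sigma> (S v2) (S (S u1)) * (S (S u2 * v1) \<rhd> b))) z) z) z) z) z) h"
    by (simp add: sw_assoc_pair lin_intros)
  also have "\<dots> = sb (\<lambda>h1 z. sb (\<lambda>h2 z. sb (\<lambda>u z. sb (\<lambda>v h7.
      (S h7 \<rhd> \<tau> (S (S h2)) (S h1)) * (\<sigma> (S v) (S (S u)) * b)) z) z) z) h"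
    by (subst sw_antip_cancel_left[where K="\<lambda>t z. sb (\<lambda>v h7.
      (S h7 \<rhd> \<tau> (S (S _)) (S _)) * (\<sigma> (S v) (S (S _)) * (S t \<rhd> b))) z"])
      (simp_all add: lin_intros antip_one one_act)
  also have "\<dots> = bs (\<epsilon> h) b"
    using act_cocinv_coc_cancel[of h, THEN arg_cong, of "\<lambda>x. x * b"] by (simp add: sw_pushes mult.assoc scale_pushes)
  finally show ?thesis .
qed

text \<open>The coefficient for the opposite composition. Here \<open>\<tau>\<close> is commuted
  past the action on \<open>b\<close>, again so that the legs acting on \<open>b\<close> become
  adjacent, and \<open>cocinv_act_coc_cancel\<close> finishes.\<close>

lemma anti_anti_inv_coefficient:
  "sb (\<lambda>h1 z. sb (\<lambda>h2 z. sb (\<lambda>h3 z. sb (\<lambda>h4 z. sb (\<lambda>h5 h6.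
     \<tau> (S h2) h3 * (S h1 \<rhd> ((h4 \<rhd> b) * \<sigma> h5 (S h6)))) z) z) z) z) h = bs (\<epsilon> h) b"
  (is "?L = _")
proof -
  have 1: "sb (\<lambda>u1 u2. sb (\<lambda>v1 v2. \<tau> (S u2) v1 * ((S u1 * v2) \<rhd> b)) v) u =
    sb (\<lambda>u1 u2. sb (\<lambda>v1 v2. ((S u2 * v1) \<rhd> b) * \<tau> (S u1) v2) v) u" for u v
    using conv2_commute(2)[of b, THEN fun_cong, THEN fun_cong, of "S u" v]
    by (simp add: conv2_def sw_antip lin_intros)
  \<comment> \<open>\<open>S h1\<close> acts on a product through its coproduct. Since the antipode
    reverses the legs, \<open>S a2\<close> meets \<open>b\<close> and \<open>S a1\<close> meets the
    cocycle.\<close>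
  have 2: "sb (\<lambda>h2 z. sb (\<lambda>h3 z. sb (\<lambda>h4 z. sb (\<lambda>h5 h6.
     \<tau> (S h2) h3 * (S h1 \<rhd> ((h4 \<rhd> b) * \<sigma> h5 (S h6)))) z) z) z) z =
    sb (\<lambda>a1 a2. sb (\<lambda>h2 z. sb (\<lambda>h3 z. sb (\<lambda>h4 z. sb (\<lambda>h5 h6.
     \<tau> (S h2) h3 * (((S a2 * h4) \<rhd> b) * (S a1 \<rhd> \<sigma> h5 (S h6)))) z) z) z) z) h1" for h1 z
    by (simp add: act_mult sw_antip lin_intros act_act sw_pushes sw_swap[where g=h1])
  have "?L = sb (\<lambda>h1 z. sb (\<lambda>u z. sb (\<lambda>v z. sb (\<lambda>u1 u2. sb (\<lambda>v1 v2. sb (\<lambda>h6 h7.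
      \<tau> (S u2) v1 * ((S u1 * v2) \<rhd> b) * (S h1 \<rhd> \<sigma> h6 (S h7))) z) v) u) z) z) h"
    unfolding 2 by (simp add: sw_assoc sw_assoc_pair lin_intros mult.assoc)
  \<comment> \<open>The common right factor is split off so that the commutation fact
    \<open>1\<close> matches the remaining double sum.\<close>
  also have "\<dots> = sb (\<lambda>h1 z. sb (\<lambda>u z. sb (\<lambda>v z. sb (\<lambda>u1 u2. sb (\<lambda>v1 v2.
      \<tau> (S u2) v1 * ((S u1 * v2) \<rhd> b)) v) u * sb (\<lambda>h6 h7. (S h1 \<rhd> \<sigma> h6 (S h7))) z) z) z) h"
    by (simp only: sw_bmult_left) (simp only: sw_bmult_right)
  also have "\<dots> = sb (\<lambda>h1 z. sb (\<lambda>u z. sb (\<lambda>v z. sb (\<lambda>u1 u2. sb (\<lambda>v1 v2. sb (\<lambda>h6 h7.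
      ((S u2 * v1) \<rhd> b) * \<tau> (S u1) v2 * (S h1 \<rhd> \<sigma> h6 (S h7))) z) v) u) z) z) h"
    unfolding 1 by (simp only: sw_bmult_left) (simp only: sw_bmult_right)
  also have "\<dots> = sb (\<lambda>h1 z. sb (\<lambda>u1 z. sb (\<lambda>u2 z. sb (\<lambda>v1 z. sb (\<lambda>v2 z. sb (\<lambda>h6 h7.
      ((S u2 * v1) \<rhd> b) * \<tau> (S u1) v2 * (S h1 \<rhd> \<sigma> h6 (S h7))) z) z) z) z) z) h"
    by (simp add: sw_assoc_pair lin_intros)
  also have "\<dots> = sb (\<lambda>h1 z. sb (\<lambda>u z. sb (\<lambda>v z. sb (\<lambda>h6 h7.
      b * \<tau> (S u) v * (S h1 \<rhd> \<sigma> h6 (S h7))) z) z) z) h"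
    by (subst sw_antip_cancel_left[where K="\<lambda>t z. sb (\<lambda>v z. sb (\<lambda>h6 h7.
      (t \<rhd> b) * \<tau> (S _) v * (S _ \<rhd> \<sigma> h6 (S h7))) z) z"])
      (simp_all add: lin_intros one_act)
  also have "\<dots> = bs (\<epsilon> h) b"
    using cocinv_act_coc_cancel[of h, THEN arg_cong, of "\<lambda>x. b * x"] by (simp add: sw_pushes mult.assoc scale_pushes)
  finally show ?thesis .
qed

text \<open>The same identity at \<open>Si h\<close>, whose legs are those of \<open>h\<close> in
  reversed order. This is the form that arises from splitting the third slot of
  \<open>anti_inv\<close>.\<close>

lemma anti_anti_inv_coefficient_Si:
  "sb (\<lambda>h1 z. sb (\<lambda>h2 z. sb (\<lambda>h3 z. sb (\<lambda>h4 z. sb (\<lambda>h5 h6.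
     \<tau> h5 (Si h4) * (h6 \<rhd> ((Si h3 \<rhd> b) * \<sigma> (Si h2) h1))) z) z) z) z) h = bs (\<epsilon> h) b"
  using anti_anti_inv_coefficient[of b "Si h"] by (simp add: sw_Si lin_intros counit_Si sw_assoc)

section \<open>The algebra structure\<close>

text \<open>The underlying space is the range of this projection of the formal linear combinations. Composing
  with it extends maps that are only multilinear on that space to all formal combinations.\<close>

definition "proj = quot_map (trilin_rels bs bs hs)"
abbreviation "cr_car \<equiv> tens3_space bs bs hs"

lemma linear_proj: "lin fscale fscale proj"
  unfolding proj_def by (rule linear_quot_map)

lemma lin_proj: "lin s fscale f \<Longrightarrow> lin s fscale (\<lambda>x. proj (f x))"
  using lin_comp linear_proj by blast

lemma in_car_iff: "X \<in> cr_car \<longleftrightarrow> proj X = X"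
  unfolding tens3_space_def proj_def using quot_map_idem by (metis rangeE rangeI)

lemma proj_in_car [simp]: "proj X \<in> cr_car"
  by (simp add: in_car_iff) (simp add: proj_def quot_map_idem)

lemma proj_ct [simp]: "proj (ct b c h) = ct b c h"
  by (simp add: proj_def cr_tens_def tens3_def quot_map_idem)

lemma ct_in_car [simp]: "ct b c h \<in> cr_car"
  by (simp add: in_car_iff)

lemma lin_ext_in_car: "(\<And>p. F p \<in> cr_car) \<Longrightarrow> lin_ext fscale F u \<in> cr_car"
  by (simp add: in_car_iff lin_ext_push[OF linear_proj])

lemma sw_in_car: "(\<And>a b. F a b \<in> cr_car) \<Longrightarrow> sw fscale F u \<in> cr_car"
  unfolding sw2_def by (rule lin_ext_in_car) auto

text \<open>Pure tensors span the carrier: writing \<open>X\<close> as a combination of points and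
  applying \<open>proj\<close>, which fixes \<open>X\<close>, turns every point into a pure
  tensor.\<close>

lemma lin_eq_on_car:
  assumes "lin fscale t f" "lin fscale t g" "\<And>b c h. f (ct b c h) = g (ct b c h)" "X \<in> cr_car"
  shows "f X = g X"
proof -
  have "X = proj (lin_ext fscale pt X)" using assms(4) by (simp add: in_car_iff lin_ext_pt_self)
  then have X: "X = lin_ext fscale (\<lambda>x. proj (pt x)) X" by (simp add: lin_ext_push[OF linear_proj])
  have p: "f (proj (pt x)) = g (proj (pt x))" for x
    using assms(3)[of "fst x" "fst (snd x)" "snd (snd x)"] by (simp add: proj_def cr_tens_def tens3_def)
  show ?thesis
    by (subst (1 2) X) (simp add: lin_ext_push[OF assms(1)] lin_ext_push[OF assms(2)] p)
qed

lemma lin_lin_ext_arg: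
  assumes "vector_space sc" "lin s fscale g"
  shows "lin s sc (\<lambda>x. lin_ext sc f (g x))"
  using lin_comp[OF assms(2) linear_lin_ext[OF assms(1)]] .

lemma lin_lin_ext3:
  assumes "vector_space t" "vector_space s" "\<And>a b c. lin s t (\<lambda>x. F x a b c)"
  shows "lin s t (\<lambda>x. lin_ext t (\<lambda>(a, b, c). F x a b c) u)"
  using lin_lin_ext[OF assms(1,2), of "\<lambda>x (a,b,c). F x a b c"] assms(3) by (simp add: case_prod_beta')

lemma lin_ext_ct:
  assumes "\<And>c h. lin bs sc (\<lambda>b. F b c h)" "\<And>b h. lin bs sc (\<lambda>c. F b c h)" "\<And>b c. lin hs sc (\<lambda>h. F b c h)"
  shows "lin_ext sc (\<lambda>(b, c, h). F b c h) (ct b c h) = F b c h"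
  unfolding cr_tens_def by (rule lin_ext_tens3) (simp_all add: bilin_def assms)

abbreviation cm (infixl "\<odot>" 70) where "X \<odot> Y \<equiv> cr_mult H C X Y"

lemma lin_cm_left: "lin s fscale f \<Longrightarrow> lin s fscale (\<lambda>x. f x \<odot> Y)"
  unfolding cr_mult_def by (rule lin_lin_ext_arg) simp_all

lemma lin_cm_right: "lin s fscale f \<Longrightarrow> lin s fscale (\<lambda>x. Y \<odot> f x)"
  unfolding cr_mult_def by (rule lin_lin_ext3) (auto intro: lin_lin_ext_arg dest: lin_vs)

lemma cm_in_car [simp]: "X \<odot> Y \<in> cr_car"
  unfolding cr_mult_def sw4_def sw3_def
  by (auto intro!: lin_ext_in_car sw_in_car simp: split_def)

lemma cm_ct: "ct b b' h \<odot> ct c c' g =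
    sf (\<lambda>h1 z. sf (\<lambda>h2 z. sf (\<lambda>h3 h4. sf (\<lambda>g1 z. sf (\<lambda>g2 z. sf (\<lambda>g3 g4.
        ct (b * (h1 \<rhd> c) * \<sigma> h2 g1) (c' * (S g4 \<rhd> b') * \<sigma> (S g3) (S h4)) (h3 * g2)) z) z) g) z) z) h"
  unfolding cr_mult_def sw4_def sw3_def
  by (simp add: lin_ext_ct lin_intros lin_lin_ext3)

section \<open>Products with source and target elements\<close>

definition "tgt_el a = ct 1 a 1"
definition "src_el a = ct a 1 1"

lemmas counit_scales = scale_pushes counits lin_intros pull_scale(2)

text \<open>Since one factor has 1 in its \<open>H\<close> slot, each cocycle in the product has an
  argument 1 and degenerates to a counit. The same happens in the next three products.\<close>

lemma tgt_ct: "tgt_el a \<odot> ct c c' g = sf (\<lambda>g1 g2. ct c (c' * (S g2 \<rhd> a)) g1) g"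
  by (simp add: tgt_el_def cm_ct sw_one lin_intros one_act coc_one_left antip_one coc_one_right counit_antip counit_scales)

lemma src_ct: "src_el a \<odot> ct c c' g = ct (a * c) c' g"
  by (simp add: src_el_def cm_ct sw_one lin_intros one_act coc_one_left antip_one coc_one_right counit_antip counit_scales act_on_one)

lemma ct_src: "ct c c' h \<odot> src_el a = sf (\<lambda>h1 h2. ct (c * (h1 \<rhd> a)) c' h2) h"
  by (simp add: src_el_def cm_ct sw_one lin_intros one_act coc_one_left antip_one coc_one_right counit_antip counit_scales act_on_one)

lemma ct_tgt: "ct c c' h \<odot> tgt_el a = ct c (a * c') h"
  by (simp add: tgt_el_def cm_ct sw_one lin_intros one_act coc_one_left antip_one coc_one_right counit_antip counit_scales act_on_one)

section \<open>Associativity when one of the factors is a source or target element\<close>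

lemmas sw_cm_left = sw_push[OF lin_cm_left[OF lin_ident[OF vector_space_fscale]]]
lemmas sw_cm_right = sw_push[OF lin_cm_right[OF lin_ident[OF vector_space_fscale]]]

lemma bilin_eq_on_car:
  assumes "\<And>Y. lin fscale t (\<lambda>X. f X Y)" "\<And>X. lin fscale t (\<lambda>Y. f X Y)"
    "\<And>Y. lin fscale t (\<lambda>X. g X Y)" "\<And>X. lin fscale t (\<lambda>Y. g X Y)"
    "\<And>b c h d e k. f (ct b c h) (ct d e k) = g (ct b c h) (ct d e k)" "X \<in> cr_car" "Y \<in> cr_car"
  shows "f X Y = g X Y"
proof (rule lin_eq_on_car[OF assms(1,3) _ assms(6)])
  fix b c h show "f (ct b c h) Y = g (ct b c h) Y"
    by (rule lin_eq_on_car[OF assms(2,4) _ assms(7)]) (rule assms(5))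
qed

text \<open>On pure tensors, both sides agree because \<open>h1\<close> acts on the product
  \<open>b * d\<close> factor by factor.\<close>

lemma assoc_src:
  assumes "Y \<in> cr_car" "V \<in> cr_car"
  shows "(Y \<odot> src_el b) \<odot> V = Y \<odot> (src_el b \<odot> V)"
proof (rule bilin_eq_on_car[OF _ _ _ _ _ assms, of fscale "\<lambda>Y V. (Y \<odot> src_el b) \<odot> V" "\<lambda>Y V. Y \<odot> (src_el b \<odot> V)"])
  fix c c' h d d' g
  have 1: "sf (\<lambda>h2 z. sf (\<lambda>h3 h4. sf (\<lambda>g1 z. sf (\<lambda>g2 z. sf (\<lambda>g3 g4.
        ct (c * (h1 \<rhd> (b * d)) * \<sigma> h2 g1) (d' * (S g4 \<rhd> c') * \<sigma> (S g3) (S h4)) (h3 * g2)) z) z) g) z) z =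
      sf (\<lambda>x y. sf (\<lambda>h2 z. sf (\<lambda>h3 h4. sf (\<lambda>g1 z. sf (\<lambda>g2 z. sf (\<lambda>g3 g4.
        ct (c * ((x \<rhd> b) * (y \<rhd> d)) * \<sigma> h2 g1) (d' * (S g4 \<rhd> c') * \<sigma> (S g3) (S h4)) (h3 * g2)) z) z) g) z) z) h1"
    for h1 z
    by (simp add: act_mult sw_pushes sw_swap[where g=h1])
  show "(ct c c' h \<odot> src_el b) \<odot> ct d d' g = ct c c' h \<odot> (src_el b \<odot> ct d d' g)"
    by (simp add: ct_src src_ct sw_cm_left cm_ct 1) (simp add: sw_assoc lin_intros mult.assoc)
qed (simp_all add: lin_intros lin_cm_left lin_cm_right)

lemma assoc_src_left:
  assumes "Y \<in> cr_car" "V \<in> cr_car"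
  shows "(src_el b \<odot> Y) \<odot> V = src_el b \<odot> (Y \<odot> V)"
  by (rule bilin_eq_on_car[OF _ _ _ _ _ assms, of fscale "\<lambda>Y V. (src_el b \<odot> Y) \<odot> V" "\<lambda>Y V. src_el b \<odot> (Y \<odot> V)"])
     (simp_all add: lin_intros lin_cm_left lin_cm_right src_ct cm_ct sw_cm_right mult.assoc)

text \<open>The counterpart of \<open>assoc_src\<close> in the second slot: there the antipode of a
  leg of \<open>g\<close> acts on the product \<open>b * c'\<close>.\<close>

lemma assoc_tgt_mid:
  assumes "Y \<in> cr_car" "V \<in> cr_car"
  shows "(Y \<odot> tgt_el b) \<odot> V = Y \<odot> (tgt_el b \<odot> V)"
proof (rule bilin_eq_on_car[OF _ _ _ _ _ assms, of fscale "\<lambda>Y V. (Y \<odot> tgt_el b) \<odot> V" "\<lambda>Y V. Y \<odot> (tgt_el b \<odot> V)"])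
  fix c c' h d d' g
  show "(ct c c' h \<odot> tgt_el b) \<odot> ct d d' g = ct c c' h \<odot> (tgt_el b \<odot> ct d d' g)"
    by (simp add: ct_tgt tgt_ct sw_cm_right cm_ct sw_swap[where h=g] act_mult sw_pushes sw_antip lin_intros)
      (simp add: sw_assoc lin_intros mult.assoc)
qed (simp_all add: lin_intros lin_cm_left lin_cm_right)

text \<open>In one product the action on \<open>a\<close> stands to the left of the cocycle in the
  second slot, in the other to its right. By \<open>act_act\<close> the acting element is a product
  of antipodes, so \<open>conv2_commute\<close> exchanges the two.\<close>

lemma assoc_tgt:
  assumes "Y \<in> cr_car" "V \<in> cr_car"
  shows "(tgt_el a \<odot> Y) \<odot> V = tgt_el a \<odot> (Y \<odot> V)"
proof (rule bilin_eq_on_car[OF _ _ _ _ _ assms, of fscale "\<lambda>Y V. (tgt_el a \<odot> Y) \<odot> V" "\<lambda>Y V. tgt_el a \<odot> (Y \<odot> V)"])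
  fix d d' h e e' g
  have 1: "sb (\<lambda>u1 u2. sb (\<lambda>v1 v2. ((S v2 * S u2) \<rhd> a) * \<sigma> (S v1) (S u1)) v) u =
    sb (\<lambda>u1 u2. sb (\<lambda>v1 v2. \<sigma> (S v2) (S u2) * ((S v1 * S u1) \<rhd> a)) v) u" for u v
    using conv2_commute(1)[of a, THEN fun_cong, THEN fun_cong, of "S v" "S u"]
    by (simp add: conv2_def sw_antip lin_intros sw_swap[where h=v])
  have 2: "sf (\<lambda>u1 u2. sf (\<lambda>v1 v2. ct x (y * (((S v2 * S u2) \<rhd> a) * \<sigma> (S v1) (S u1))) k) v) u =
    sf (\<lambda>u1 u2. sf (\<lambda>v1 v2. ct x (y * (\<sigma> (S v2) (S u2) * ((S v1 * S u1) \<rhd> a))) k) v) u" for u v x y k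
    unfolding sw_ct2[symmetric] sw_bmult_right[symmetric] 1 ..
  have 3: "sf (\<lambda>g1 z. sf (\<lambda>g2 z. sf (\<lambda>v g5. sf (\<lambda>u1 u2. sf (\<lambda>v1 v2. F g1 g2 v1 v2 g5 u1 u2) v) u) z) z) g =
    sf (\<lambda>u1 u2. sf (\<lambda>g1 z. sf (\<lambda>g2 z. sf (\<lambda>v g5. sf (\<lambda>v1 v2. F g1 g2 v1 v2 g5 u1 u2) v) z) z) g) u"
     for u and F :: "'h \<Rightarrow> 'h \<Rightarrow> 'h \<Rightarrow> 'h \<Rightarrow> 'h \<Rightarrow> 'h \<Rightarrow> 'h \<Rightarrow> ('k, 'h, 'b) cr"
    by (simp add: sw_swap[where g=u])
  \<comment> \<open>The outer product with \<open>tgt_el a\<close> splits the third slot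
    \<open>h3 * g2\<close>; multiplicativity of the coproduct separates this into a split of
    \<open>h3\<close> and one of \<open>g2\<close>.\<close>
  have 4: "sf (\<lambda>g3 g4. sf (\<lambda>w1 w2. ct (F g3 g4) (F' g3 g4 * (S w2 \<rhd> a)) w1) (h3 * g2)) z =
    sf (\<lambda>x y. sf (\<lambda>p q. sf (\<lambda>g3 g4. ct (F g3 g4) (F' g3 g4 * ((S q * S y) \<rhd> a)) (x * p)) z) g2) h3" for F F' h3 g2 z
    by (simp add: sw_mult lin_intros antip_mult sw_swap[where g=h3]) (simp add: sw_swap[where g=g2 and h=z])
  have 5: "sf (\<lambda>g1 z. sf (\<lambda>g2 z. sf (\<lambda>x y. sf (\<lambda>p q. sf (\<lambda>g3 g4. F g1 p q g3 g4 x y) z) g2) h3) z) g =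
    sf (\<lambda>x y. sf (\<lambda>g1 z. sf (\<lambda>g2 z. sf (\<lambda>p q. sf (\<lambda>g3 g4. F g1 p q g3 g4 x y) z) g2) z) g) h3"
     for h3 and F :: "'h \<Rightarrow> 'h \<Rightarrow> 'h \<Rightarrow> 'h \<Rightarrow> 'h \<Rightarrow> 'h \<Rightarrow> 'h \<Rightarrow> ('k, 'h, 'b) cr"
    by (simp add: sw_swap[where g=h3])
  have "(tgt_el a \<odot> ct d d' h) \<odot> ct e e' g =
    sf (\<lambda>h1 z. sf (\<lambda>h2 z. sf (\<lambda>h3 u. sf (\<lambda>u1 u2. sf (\<lambda>g1 z. sf (\<lambda>g2 z. sf (\<lambda>v g5. sf (\<lambda>v1 v2.
      ct (d * (h1 \<rhd> e) * \<sigma> h2 g1) (e' * (S g5 \<rhd> d') * (((S v2 * S u2) \<rhd> a) * \<sigma> (S v1) (S u1))) (h3 * g2)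
      ) v) z) z) g) u) z) z) h"
    by (simp add: tgt_ct sw_cm_left cm_ct act_mult act_act sw_antip lin_intros sw_pushes) (simp add: sw_assoc lin_intros mult.assoc)
  also have "\<dots> =
    sf (\<lambda>h1 z. sf (\<lambda>h2 z. sf (\<lambda>h3 u. sf (\<lambda>u1 u2. sf (\<lambda>g1 z. sf (\<lambda>g2 z. sf (\<lambda>v g5. sf (\<lambda>v1 v2.
      ct (d * (h1 \<rhd> e) * \<sigma> h2 g1) (e' * (S g5 \<rhd> d') * (\<sigma> (S v2) (S u2) * ((S v1 * S u1) \<rhd> a))) (h3 * g2)
      ) v) z) z) g) u) z) z) h"
    unfolding 3[symmetric] 2 ..
  also have "\<dots> = tgt_el a \<odot> (ct d d' h \<odot> ct e e' g)"
    by (simp add: tgt_ct sw_cm_right cm_ct 4 5) (simp add: sw_assoc lin_intros mult.assoc)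
  finally show "(tgt_el a \<odot> ct d d' h) \<odot> ct e e' g = tgt_el a \<odot> (ct d d' h \<odot> ct e e' g)" .
qed (simp_all add: lin_intros lin_cm_left lin_cm_right)

section \<open>The coproduct and the antipode\<close>

lemma cr_ring_sel [simp]: "car (cr_ring H C) = cr_car" "lsc (cr_ring H C) = fscale"
  "lmult (cr_ring H C) = cr_mult H C" "lone (cr_ring H C) = ct 1 1 1"
  "src (cr_ring H C) = src_el" "tgt (cr_ring H C) = tgt_el"
  by (auto simp: cr_ring_def src_el_def tgt_el_def)

section \<open>The tensor product over B\<close>

definition "bal_rels = bilin_rels cr_car fscale cr_car fscale
     \<union> {pt (tgt_el b \<odot> U, V) - pt (U, src_el b \<odot> V) | b U V. U \<in> cr_car \<and> V \<in> cr_car}"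

text \<open>Projecting both arguments makes this bilinear on all formal combinations, while it still
  agrees with \<open>btens\<close> on the carrier.\<close>

definition "bal X Y = quot_map bal_rels (pt (proj X, proj Y))"

lemma btens_cr: "btens (cr_ring H C) X Y = quot_map bal_rels (pt (X, Y))"
  by (simp add: btens_def bal_rels_def)

lemma btens_eq_bal: "X \<in> cr_car \<Longrightarrow> Y \<in> cr_car \<Longrightarrow> btens (cr_ring H C) X Y = bal X Y"
  by (simp add: btens_cr bal_def in_car_iff)

lemma linear_bal: "lin fscale fscale (\<lambda>X. bal X Y)" "lin fscale fscale (\<lambda>Y. bal X Y)"
proof -
  have "bilin_rels cr_car fscale cr_car fscale \<subseteq> bal_rels" by (auto simp: bal_rels_def)
  note * = linear_quot_bilin[OF this]
  show "lin fscale fscale (\<lambda>X. bal X Y)" "lin fscale fscale (\<lambda>Y. bal X Y)"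
    by (simp_all add: linear_iff_expanded bal_def lin_add[OF linear_proj] lin_scale[OF linear_proj] *)
qed

lemma lin_bal_left: "lin s fscale f \<Longrightarrow> lin s fscale (\<lambda>x. bal (f x) Y)"
  and lin_bal_right: "lin s fscale f \<Longrightarrow> lin s fscale (\<lambda>x. bal Y (f x))"
  using lin_comp linear_bal by blast+

lemma bal_balanced:
  assumes "U \<in> cr_car" "V \<in> cr_car"
  shows "bal (tgt_el b \<odot> U) V = bal U (src_el b \<odot> V)"
proof -
  have "pt (tgt_el b \<odot> U, V) - pt (U, src_el b \<odot> V) \<in> bal_rels"
    unfolding bal_rels_def using assms by blast
  then have "quot_map bal_rels (pt (tgt_el b \<odot> U, V)) = quot_map bal_rels (pt (U, src_el b \<odot> V))"
    unfolding quot_map_eq_iff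
    by (rule module.span_base[OF module_iff_vector_space[THEN iffD2, OF vector_space_fscale]])
  then show ?thesis using assms by (simp add: btens_eq_bal flip: btens_cr)
qed

text \<open>The universal property of the tensor product over B. \<open>F\<close> is bilinear
  everywhere, whereas \<open>F'\<close>, the function in the antipode axioms, is compared with it on
  the carrier alone.\<close>

lemma lin_ext_btens:
  assumes l: "\<And>Y. lin fscale sc (\<lambda>X. F X Y)" "\<And>X. lin fscale sc (\<lambda>Y. F X Y)"
    and b: "\<And>b U V. U \<in> cr_car \<Longrightarrow> V \<in> cr_car \<Longrightarrow> F (tgt_el b \<odot> U) V = F U (src_el b \<odot> V)"
    and eq: "\<And>X Y. X \<in> cr_car \<Longrightarrow> Y \<in> cr_car \<Longrightarrow> F' X Y = F X Y"
    and XY: "X \<in> cr_car" "Y \<in> cr_car"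
  shows "lin_ext sc (\<lambda>(X, Y). F' X Y) (bal X Y) = F X Y"
proof -
  have vs: "vector_space sc" using l lin_vs by blast
  interpret e: Vector_Spaces.linear fscale sc "lin_ext sc (\<lambda>(X, Y). F' X Y)" by (rule linear_lin_ext[OF vs])
  have A: "X + Y \<in> cr_car" if "X \<in> cr_car" "Y \<in> cr_car" for X Y
    using that by (simp add: in_car_iff lin_add[OF linear_proj])
  have B: "fscale r X \<in> cr_car" if "X \<in> cr_car" for X r
    using that by (simp add: in_car_iff lin_scale[OF linear_proj])
  have 0: "lin_ext sc (\<lambda>(X, Y). F' X Y) g = 0" if "g \<in> bal_rels" for g
    using that
    by (auto simp: bal_rels_def bilin_rels_def e.diff e.scale lin_ext_pt[OF vs] eq A B b
      lin_add[OF l(1)] lin_add[OF l(2)] lin_scale[OF l(1)] lin_scale[OF l(2)])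
  have "lin_ext sc (\<lambda>(X, Y). F' X Y) (quot_map bal_rels (pt (X, Y))) = lin_ext sc (\<lambda>(X, Y). F' X Y) (pt (X, Y))"
    by (rule lin_ext_quot_map[OF vs 0])
  then show ?thesis using XY by (simp add: bal_def in_car_iff lin_ext_pt[OF vs] eq)
qed

abbreviation "L \<equiv> cr_bialgebroid H C"

lemma cr_bialgebroid_sel [simp]: "car L = cr_car" "lsc L = fscale"
  "lmult L = cr_mult H C" "lone L = ct 1 1 1" "src L = src_el" "tgt L = tgt_el"
  by (auto simp: cr_bialgebroid_def base_ring_data.defs bialgebroid_data.defs cr_ring_def src_el_def tgt_el_def)

lemma btens_L: "btens L = btens (cr_ring H C)"
  by (intro ext) (simp add: btens_def)

lemma cop_L: "cop L X = lin_ext fscale (\<lambda>(b, c, h). sf (\<lambda>h1 z. sf (\<lambda>h2 z. sf (\<lambda>h3 h4.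
  bal (ct b (\<tau> (S h2) h3) h1) (ct 1 c h4)) z) z) h) X"
  by (simp add: cr_bialgebroid_def base_ring_data.defs bialgebroid_data.defs btens_eq_bal sw4_eq sw3_eq)

section \<open>The antipode and its inverse\<close>

definition "anti X = lin_ext fscale (\<lambda>(b, c, h). sf (\<lambda>h1 z. sf (\<lambda>h2 z. sf (\<lambda>h3 h4.
         ct c (\<tau> (S (S h2)) (S h1) * (S (S h3) \<rhd> b)) (S h4)) z) z) h) X"

definition "anti_inv X = lin_ext fscale (\<lambda>(b, c, h). sf (\<lambda>h1 z. sf (\<lambda>h2 z. sf (\<lambda>h3 h4.
         ct ((h2 \<rhd> c) * \<sigma> h3 (S h4)) b (Si h1)) z) z) h) X"

lemma lin_anti: "lin s fscale f \<Longrightarrow> lin s fscale (\<lambda>x. anti (f x))"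
  and lin_anti_inv: "lin s fscale f \<Longrightarrow> lin s fscale (\<lambda>x. anti_inv (f x))"
  unfolding anti_def anti_inv_def by (simp_all add: lin_lin_ext_arg)

lemma anti_ct: "anti (ct b c h) = sf (\<lambda>h1 z. sf (\<lambda>h2 z. sf (\<lambda>h3 h4.
         ct c (\<tau> (S (S h2)) (S h1) * (S (S h3) \<rhd> b)) (S h4)) z) z) h"
  unfolding anti_def by (simp add: lin_ext_ct lin_intros)

lemma anti_inv_ct: "anti_inv (ct b c h) = sf (\<lambda>h1 z. sf (\<lambda>h2 z. sf (\<lambda>h3 h4.
         ct ((h2 \<rhd> c) * \<sigma> h3 (S h4)) b (Si h1)) z) z) h"
  unfolding anti_inv_def by (simp add: lin_ext_ct lin_intros)

lemmas sw_anti = sw_push[OF lin_anti[OF lin_ident[OF vector_space_fscale]]]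
lemmas sw_anti_inv = sw_push[OF lin_anti_inv[OF lin_ident[OF vector_space_fscale]]]
lemmas sw_bal_left = sw_push[OF lin_bal_left[OF lin_ident[OF vector_space_fscale]]]
lemmas sw_bal_right = sw_push[OF lin_bal_right[OF lin_ident[OF vector_space_fscale]]]

lemmas lin_maps = lin_intros lin_cm_left lin_cm_right lin_bal_left lin_bal_right lin_anti lin_anti_inv lin_proj

lemma anti_in_car [simp]: "anti X \<in> cr_car"
  unfolding anti_def by (auto intro!: lin_ext_in_car sw_in_car simp: split_def)

lemma anti_inv_in_car [simp]: "anti_inv X \<in> cr_car"
  unfolding anti_inv_def by (auto intro!: lin_ext_in_car sw_in_car simp: split_def)

text \<open>\<open>Si\<close> undoes \<open>S\<close> on the last leg \<open>k\<close>, which stays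
  in the third slot. The other legs form the coefficient of
  \<open>anti_inv_anti_coefficient\<close>, and the counit it leaves is absorbed by
  \<open>k\<close>.\<close>

lemma anti_inv_anti:
  assumes "X \<in> cr_car"
  shows "anti_inv (anti X) = X"
proof (rule lin_eq_on_car[OF _ _ _ assms, of fscale "\<lambda>X. anti_inv (anti X)" "\<lambda>X. X"])
  fix b c h
  have 1: "sf (\<lambda>h1 z. sf (\<lambda>h2 z. sf (\<lambda>h3 z. sf (\<lambda>h4 z. sf (\<lambda>h5 h6.
     ct ((S h6 \<rhd> (\<tau> (S (S h2)) (S h1) * (S (S h3) \<rhd> b))) * \<sigma> (S h5) (S (S h4))) c k) z) z) z) z) w =
     fscale (\<epsilon> w) (ct b c k)" for w k
    unfolding sw_ct1[symmetric] anti_inv_anti_coefficient scale_pushes ..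
  have "anti_inv (anti (ct b c h)) = sf (\<lambda>w k. sf (\<lambda>h1 z. sf (\<lambda>h2 z. sf (\<lambda>h3 z. sf (\<lambda>h4 z. sf (\<lambda>h5 h6.
     ct ((S h6 \<rhd> (\<tau> (S (S h2)) (S h1) * (S (S h3) \<rhd> b))) * \<sigma> (S h5) (S (S h4))) c k) z) z) z) z) w) h"
    by (simp add: anti_ct sw_anti_inv anti_inv_ct sw_antip lin_intros sw_assoc)
  also have "\<dots> = ct b c h" unfolding 1 by (simp add: counits lin_intros)
  finally show "anti_inv (anti (ct b c h)) = ct b c h" .
qed (simp_all add: lin_maps)

text \<open>Splitting \<open>Si h1\<close> reverses the legs, so the first leg of \<open>h\<close>
  ends up alone in the third slot and the others form the coefficient of
  \<open>anti_anti_inv_coefficient\<close>.\<close>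

lemma anti_anti_inv:
  assumes "X \<in> cr_car"
  shows "anti (anti_inv X) = X"
proof (rule lin_eq_on_car[OF _ _ _ assms, of fscale "\<lambda>X. anti (anti_inv X)" "\<lambda>X. X"])
  fix b c h
  have 1: "sf (\<lambda>h1 z. sf (\<lambda>h2 z. sf (\<lambda>h3 z. sf (\<lambda>h4 z. sf (\<lambda>h5 h6.
     ct b (\<tau> (S h2) h3 * (S h1 \<rhd> ((h4 \<rhd> c) * \<sigma> h5 (S h6)))) k) z) z) z) z) w =
     fscale (\<epsilon> w) (ct b c k)" for w k
    unfolding sw_ct2[symmetric] anti_anti_inv_coefficient scale_pushes ..
  \<comment> \<open>Collecting the sum in the first slot into one element of B leaves
    \<open>Si h1\<close> as the only leg that \<open>anti\<close> has to split.\<close>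
  have 2: "anti_inv (ct b c h) = sf (\<lambda>h1 z. ct (sb (\<lambda>h2 z. sb (\<lambda>h3 h4. (h2 \<rhd> c) * \<sigma> h3 (S h4)) z) z) b (Si h1)) h"
    by (simp add: anti_inv_ct sw_pushes)
  have "anti (anti_inv (ct b c h)) = sf (\<lambda>k z. sf (\<lambda>h1 z. sf (\<lambda>h2 z. sf (\<lambda>h3 z. sf (\<lambda>h4 z. sf (\<lambda>h5 h6.
     ct b (\<tau> (S h2) h3 * (S h1 \<rhd> ((h4 \<rhd> c) * \<sigma> h5 (S h6)))) k) z) z) z) z) z) h"
    unfolding 2 by (simp add: sw_anti anti_ct sw_Si lin_intros) (simp add: sw_pushes sw_assoc lin_intros)
  also have "\<dots> = ct b c h" unfolding 1 by (simp add: counits lin_intros)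
  finally show "anti (anti_inv (ct b c h)) = ct b c h" .
qed (simp_all add: lin_maps)

text \<open>On the left the last leg of \<open>h\<close> acts on \<open>a\<close> through
  \<open>S\<close>. On the right \<open>a\<close> is acted on by the first leg of the split of
  \<open>S h4\<close>, which is \<open>S\<close> of that same last leg.\<close>

lemma anti_tgt:
  assumes "X \<in> cr_car"
  shows "anti (tgt_el a \<odot> X) = anti X \<odot> src_el a"
proof (rule lin_eq_on_car[OF _ _ _ assms, of fscale "\<lambda>X. anti (tgt_el a \<odot> X)" "\<lambda>X. anti X \<odot> src_el a"])
  fix b c h
  show "anti (tgt_el a \<odot> ct b c h) = anti (ct b c h) \<odot> src_el a"
    by (simp add: tgt_ct sw_anti anti_ct ct_src sw_cm_left sw_antip sw_assoc lin_intros)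
qed (simp_all add: lin_maps)

lemma anti_inv_src:
  assumes "X \<in> cr_car"
  shows "anti_inv (src_el a \<odot> X) = anti_inv X \<odot> tgt_el a"
proof (rule lin_eq_on_car[OF _ _ _ assms, of fscale "\<lambda>X. anti_inv (src_el a \<odot> X)" "\<lambda>X. anti_inv X \<odot> tgt_el a"])
  fix b c h
  show "anti_inv (src_el a \<odot> ct b c h) = anti_inv (ct b c h) \<odot> tgt_el a"
    by (simp add: src_ct anti_inv_ct ct_tgt sw_cm_left)
qed (simp_all add: lin_maps)

text \<open>A function that respects the balancing can be evaluated on the formula for the
  coproduct, whatever combination of pairs represents the value of \<open>cop\<close>.\<close>

lemma lin_ext_cop:
  assumes l: "\<And>Y. lin fscale sc (\<lambda>X. F X Y)" "\<And>X. lin fscale sc (\<lambda>Y. F X Y)"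
    and b: "\<And>b U V. U \<in> cr_car \<Longrightarrow> V \<in> cr_car \<Longrightarrow> F (tgt_el b \<odot> U) V = F U (src_el b \<odot> V)"
    and eq: "\<And>X Y. X \<in> cr_car \<Longrightarrow> Y \<in> cr_car \<Longrightarrow> F' X Y = F X Y"
  shows "lin_ext sc (\<lambda>(X, Y). F' X Y) (cop L Z) = lin_ext sc (\<lambda>(b, c, h). sw sc (\<lambda>h1 z. sw sc (\<lambda>h2 z. sw sc (\<lambda>h3 h4.
     F (ct b (\<tau> (S h2) h3) h1) (ct 1 c h4)) z) z) h) Z"
proof -
  have vs: "vector_space sc" using l lin_vs by blast
  define G where "G = lin_ext sc (\<lambda>(X, Y). F' X Y)"
  have E: "lin fscale sc G" unfolding G_def by (rule linear_lin_ext[OF vs])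
  have "G (bal X Y) = F X Y" if "X \<in> cr_car" "Y \<in> cr_car" for X Y
    unfolding G_def using lin_ext_btens[OF l b eq that] .
  then have "G (cop L Z) = lin_ext sc (\<lambda>(b, c, h). sw sc (\<lambda>h1 z. sw sc (\<lambda>h2 z. sw sc (\<lambda>h3 h4.
     F (ct b (\<tau> (S h2) h3) h1) (ct 1 c h4)) z) z) h) Z"
    by (simp add: cop_L lin_ext_push[OF E] sw_push[OF E] case_prod_beta')
  then show ?thesis by (simp add: G_def)
qed

text \<open>With (W1, W2) the coproduct of \<open>W\<close>, this is W1 \<open>V\<close> tensored
  with W2: the inner expression of the antipode axiom for \<open>S\<close>, regarded as a function
  of both arguments.\<close>

definition "cop_mult_fst V W = lin_ext fscale (\<lambda>(b, c, h). sf (\<lambda>h1 z. sf (\<lambda>h2 z. sf (\<lambda>h3 h4.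
     bal (ct b (\<tau> (S h2) h3) h1 \<odot> V) (ct 1 c h4)) z) z) h) W"

definition "cop_mult_snd U W = lin_ext fscale (\<lambda>(b, c, h). sf (\<lambda>h1 z. sf (\<lambda>h2 z. sf (\<lambda>h3 h4.
     bal (ct b (\<tau> (S h2) h3) h1) (ct 1 c h4 \<odot> U)) z) z) h) W"

lemma lin_cop_mult_fst_left: "lin s fscale f \<Longrightarrow> lin s fscale (\<lambda>x. cop_mult_fst (f x) W)"
  unfolding cop_mult_fst_def using lin_vs(1)[of s fscale f] by (intro lin_lin_ext3) (simp_all add: lin_maps)

lemma lin_cop_mult_snd_left: "lin s fscale f \<Longrightarrow> lin s fscale (\<lambda>x. cop_mult_snd (f x) W)"
  unfolding cop_mult_snd_def using lin_vs(1)[of s fscale f] by (intro lin_lin_ext3) (simp_all add: lin_maps)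

lemma lin_cop_mult_fst_right: "lin s fscale f \<Longrightarrow> lin s fscale (\<lambda>x. cop_mult_fst V (f x))"
  and lin_cop_mult_snd_right: "lin s fscale f \<Longrightarrow> lin s fscale (\<lambda>x. cop_mult_snd V (f x))"
  unfolding cop_mult_fst_def cop_mult_snd_def by (simp_all add: lin_lin_ext_arg)

lemma cop_mult_fst_ct: "cop_mult_fst V (ct b c h) = sf (\<lambda>h1 z. sf (\<lambda>h2 z. sf (\<lambda>h3 h4.
     bal (ct b (\<tau> (S h2) h3) h1 \<odot> V) (ct 1 c h4)) z) z) h"
  unfolding cop_mult_fst_def by (simp add: lin_ext_ct lin_maps)

lemma cop_mult_snd_ct: "cop_mult_snd V (ct b c h) = sf (\<lambda>h1 z. sf (\<lambda>h2 z. sf (\<lambda>h3 h4.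
     bal (ct b (\<tau> (S h2) h3) h1) (ct 1 c h4 \<odot> V)) z) z) h"
  unfolding cop_mult_snd_def by (simp add: lin_ext_ct lin_maps)

lemmas lin_cops = lin_maps lin_cop_mult_fst_left lin_cop_mult_fst_right lin_cop_mult_snd_left lin_cop_mult_snd_right
lemmas sw_cop_mult_fst = sw_push[OF lin_cop_mult_fst_right[OF lin_ident[OF vector_space_fscale]]]
lemmas sw_cop_mult_snd = sw_push[OF lin_cop_mult_snd_right[OF lin_ident[OF vector_space_fscale]]]

text \<open>The inner function is balanced because right multiplication by \<open>V\<close>
  associates with a target element on the left, by \<open>assoc_tgt\<close>.\<close>

lemma lin_ext_cop_mult_fst:
  assumes "V \<in> cr_car"
  shows "lin_ext fscale (\<lambda>(Y1, Y2). btens L (Y1 \<odot> V) Y2) (cop L W) = cop_mult_fst V W"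
  unfolding cop_mult_fst_def
  by (rule lin_ext_cop[where F="\<lambda>Y1 Y2. bal (Y1 \<odot> V) Y2"])
    (simp_all add: lin_maps assms assoc_tgt bal_balanced btens_L btens_eq_bal)

lemma lin_ext_cop_mult_snd:
  assumes "V \<in> cr_car"
  shows "lin_ext fscale (\<lambda>(Y1, Y2). btens L Y1 (Y2 \<odot> V)) (cop L W) = cop_mult_snd V W"
  unfolding cop_mult_snd_def
  by (rule lin_ext_cop[where F="\<lambda>Y1 Y2. bal Y1 (Y2 \<odot> V)"])
    (simp_all add: lin_maps assms assoc_src_left bal_balanced btens_L btens_eq_bal)

text \<open>This makes the outer sum balanced: a target element on X1 leaves the antipode as a
  source element on the right, sits on the first leg of the coproduct, and is passed on to X2 by
  \<open>assoc_src\<close>.\<close>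

lemma cop_mult_fst_src:
  assumes "V \<in> cr_car" "W \<in> cr_car"
  shows "cop_mult_fst V (W \<odot> src_el a) = cop_mult_fst (src_el a \<odot> V) W"
proof (rule lin_eq_on_car[OF _ _ _ assms(2), of fscale "\<lambda>W. cop_mult_fst V (W \<odot> src_el a)" "\<lambda>W. cop_mult_fst (src_el a \<odot> V) W"])
  fix b c h
  have 1: "sf (\<lambda>h2 z. sf (\<lambda>h3 h4. bal (ct b (\<tau> (S h2) h3) h1 \<odot> (src_el a \<odot> V)) (ct 1 c h4)) z) z =
     sf (\<lambda>x y. sf (\<lambda>h2 z. sf (\<lambda>h3 h4. bal (ct (b * (x \<rhd> a)) (\<tau> (S h2) h3) y \<odot> V) (ct 1 c h4)) z) z) h1" for h1 z
    by (simp add: assms(1) ct_src sw_cm_left sw_bal_left sw_swap[where g=h1] flip: assoc_src)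
  show "cop_mult_fst V (ct b c h \<odot> src_el a) = cop_mult_fst (src_el a \<odot> V) (ct b c h)"
    by (simp add: cop_mult_fst_ct ct_src sw_cop_mult_fst 1) (simp add: sw_assoc lin_maps)
qed (simp_all add: lin_cops)

text \<open>Likewise, a source element on X2 leaves \<open>anti_inv\<close> as a target element,
  which the coproduct puts on its second leg and \<open>assoc_tgt_mid\<close> passes on to
  X1.\<close>

lemma cop_mult_snd_tgt:
  assumes "V \<in> cr_car" "W \<in> cr_car"
  shows "cop_mult_snd V (W \<odot> tgt_el a) = cop_mult_snd (tgt_el a \<odot> V) W"
proof (rule lin_eq_on_car[OF _ _ _ assms(2), of fscale "\<lambda>W. cop_mult_snd V (W \<odot> tgt_el a)" "\<lambda>W. cop_mult_snd (tgt_el a \<odot> V) W"])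
  fix b c h
  show "cop_mult_snd V (ct b c h \<odot> tgt_el a) = cop_mult_snd (tgt_el a \<odot> V) (ct b c h)"
    by (simp add: cop_mult_snd_ct ct_tgt assms(1) flip: assoc_tgt_mid)
qed (simp_all add: lin_cops)

section \<open>The last two antipode axioms on pure tensors\<close>

lemma sw_pull:
  "sf (\<lambda>p z. sf (\<lambda>q v. sf (\<lambda>a1 y. sf (\<lambda>a2 a3. F p q v a1 a2 a3) y) a) z) h =
   sf (\<lambda>a1 y. sf (\<lambda>a2 a3. sf (\<lambda>p z. sf (\<lambda>q v. F p q v a1 a2 a3) z) h) y) a"
proof -
  have i: "sf (\<lambda>p z. sf (\<lambda>q v. sf (\<lambda>a2 a3. F p q v a1 a2 a3) y) z) h =
    sf (\<lambda>a2 a3. sf (\<lambda>p z. sf (\<lambda>q v. F p q v a1 a2 a3) z) h) y" for a1 y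
    by (simp add: sw_swap[where g=y])
  show ?thesis by (simp add: sw_swap[where g=a] i)
qed

lemma sw_cocinv_coc_pair:
  "sf (\<lambda>u1 u2. sf (\<lambda>y1 y2. ct (b * (\<tau> (S u2) y1 * \<sigma> (S u1) y2)) c k) y) u = fscale (\<epsilon> u) (fscale (\<epsilon> y) (ct b c k))"
  "sf (\<lambda>u1 u2. sf (\<lambda>y1 y2. ct c (b * (\<tau> (S u2) y1 * \<sigma> (S u1) y2)) k) y) u = fscale (\<epsilon> u) (fscale (\<epsilon> y) (ct c b k))"
proof -
  have 1: "sb (\<lambda>u1 u2. sb (\<lambda>y1 y2. \<tau> (S u2) y1 * \<sigma> (S u1) y2) y) u = bs (\<epsilon> u) (bs (\<epsilon> y) 1)"
    using cocinv_coc[where h="S u" and g=y] by (simp add: sw_antip lin_intros counit_antip)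
  show "sf (\<lambda>u1 u2. sf (\<lambda>y1 y2. ct (b * (\<tau> (S u2) y1 * \<sigma> (S u1) y2)) c k) y) u = fscale (\<epsilon> u) (fscale (\<epsilon> y) (ct b c k))"
    "sf (\<lambda>u1 u2. sf (\<lambda>y1 y2. ct c (b * (\<tau> (S u2) y1 * \<sigma> (S u1) y2)) k) y) u = fscale (\<epsilon> u) (fscale (\<epsilon> y) (ct c b k))"
    unfolding sw_ct1[symmetric] sw_ct2[symmetric] sw_bmult_right[symmetric] 1
    by (simp_all add: scale_pushes del: B.scale_scale)
qed

lemma ct_S_mult: "ct e f (S a) \<odot> ct 1 c v = sf (\<lambda>a1 y. sf (\<lambda>a2 a3. sf (\<lambda>v1 z. sf (\<lambda>v2 z. sf (\<lambda>v3 v4.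
    ct (e * \<sigma> (S a3) v1) (c * (S v4 \<rhd> f) * \<sigma> (S v3) (S (S a1))) (S a2 * v2)) z) z) v) y) a"
  by (simp add: cm_ct sw_antip act_on_one counit_scales sw_assoc counit_antip)

text \<open>The first tensor factor of the axiom for \<open>S\<close>. The pair of
  \<open>\<tau>\<close> and \<open>\<sigma>\<close> in the first slot cancels, then
  \<open>S a2 * v2\<close> in the third slot becomes 1, and the second slot is the left side of
  \<open>act_cocinv_coc_cancel\<close> multiplied by \<open>c\<close>.\<close>

lemma cop_mult_fst_collapse:
  "sf (\<lambda>k5 z. sf (\<lambda>k6 z. sf (\<lambda>a z. sf (\<lambda>p z. sf (\<lambda>q v.
     ct (\<tau> (S p) q) (\<tau> (S (S k6)) (S k5)) (S a) \<odot> ct 1 c v) z) z) z) z) w = fscale (\<epsilon> w) (tgt_el c)" (is "?l = _")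
proof -
  have 0: "sf (\<lambda>p z. sf (\<lambda>q v. ct (\<tau> (S p) q) f (S a) \<odot> ct 1 c v) z) z =
     sf (\<lambda>a1 y. sf (\<lambda>a2 a3. sf (\<lambda>p z. sf (\<lambda>q v. sf (\<lambda>v1 z. sf (\<lambda>v2 z. sf (\<lambda>v3 v4.
     ct (\<tau> (S p) q * \<sigma> (S a3) v1) (c * (S v4 \<rhd> f) * \<sigma> (S v3) (S (S a1))) (S a2 * v2)) z) z) v) z) z) y) a" for f a z
    unfolding ct_S_mult by (rule sw_pull)
  \<comment> \<open>The neighbouring legs \<open>a3\<close>, \<open>p\<close> are merged into
    \<open>u\<close> and \<open>q\<close>, \<open>v1\<close> into \<open>y\<close>; the factor 1
    gives the first slot the shape of \<open>sw_cocinv_coc_pair\<close>.\<close>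
  have "?l = sf (\<lambda>k5 z. sf (\<lambda>k6 z. sf (\<lambda>a1 z. sf (\<lambda>a2 z. sf (\<lambda>u z. sf (\<lambda>y z. sf (\<lambda>u1 u2. sf (\<lambda>y1 y2.
     sf (\<lambda>v2 z. sf (\<lambda>v3 v4.
     ct (1 * (\<tau> (S u2) y1 * \<sigma> (S u1) y2)) (c * (S v4 \<rhd> \<tau> (S (S k6)) (S k5)) * \<sigma> (S v3) (S (S a1))) (S a2 * v2)
     ) z) z) y) u) z) z) z) z) z) w"
    unfolding 0 by (simp add: sw_assoc sw_assoc_pair lin_intros)
  also have "\<dots> = sf (\<lambda>k5 z. sf (\<lambda>k6 z. sf (\<lambda>a1 z. sf (\<lambda>a2 z. sf (\<lambda>u z. sf (\<lambda>y z.
     sf (\<lambda>v2 z. sf (\<lambda>v3 v4. sf (\<lambda>u1 u2. sf (\<lambda>y1 y2.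
     ct (1 * (\<tau> (S u2) y1 * \<sigma> (S u1) y2)) (c * (S v4 \<rhd> \<tau> (S (S k6)) (S k5)) * \<sigma> (S v3) (S (S a1))) (S a2 * v2)
     ) y) u) z) z) z) z) z) z) z) w"
  proof -
    have 1: "sf (\<lambda>y1 y2. sf (\<lambda>v2 z. sf (\<lambda>v3 v4. F v2 v3 v4 y1 y2) z) z) y =
      sf (\<lambda>v2 z. sf (\<lambda>v3 v4. sf (\<lambda>y1 y2. F v2 v3 v4 y1 y2) y) z) z"
      for F :: "'h \<Rightarrow> 'h \<Rightarrow> 'h \<Rightarrow> 'h \<Rightarrow> 'h \<Rightarrow> ('k, 'h, 'b) cr" and y z
      by (simp add: sw_swap[where h=y])
    show ?thesis unfolding 1 ..
  qed
  also have "\<dots> = sf (\<lambda>k5 z. sf (\<lambda>k6 z. sf (\<lambda>a1 z. sf (\<lambda>a2 z.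
     sf (\<lambda>v2 z. sf (\<lambda>v3 v4. ct 1 (c * (S v4 \<rhd> \<tau> (S (S k6)) (S k5)) * \<sigma> (S v3) (S (S a1))) (S a2 * v2)
     ) z) z) z) z) z) w"
    unfolding sw_cocinv_coc_pair by (simp add: counit_scales)
  also have "\<dots> = sf (\<lambda>k5 z. sf (\<lambda>k6 z. sf (\<lambda>a1 z.
     sf (\<lambda>v3 v4. ct 1 (c * ((S v4 \<rhd> \<tau> (S (S k6)) (S k5)) * \<sigma> (S v3) (S (S a1)))) 1) z) z) z) w"
    by (subst sw_antip_cancel_left[where K="\<lambda>t z. sf (\<lambda>v3 v4.
      ct 1 (c * (S v4 \<rhd> \<tau> (S (S _)) (S _)) * \<sigma> (S v3) (S (S _))) t) z"]) (simp_all add: lin_intros mult.assoc)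
  also have "\<dots> = fscale (\<epsilon> w) (tgt_el c)"
    unfolding sw_ct2[symmetric] sw_bmult_right[symmetric] act_cocinv_coc_cancel by (simp add: scale_pushes tgt_el_def)
  finally show ?thesis .
qed

text \<open>\<open>Si\<close> is antimultiplicative, so \<open>Si b * a\<close> is
  \<open>Si (S a * b)\<close> and the cancellation for \<open>S\<close> applies.\<close>

lemma sw_Si_cancel:
  assumes "\<And>y. lin hs sc (\<lambda>x. K x y)" "\<And>x. lin hs sc (\<lambda>y. K x y)"
  shows "sw sc (\<lambda>a z. sw sc (\<lambda>b y. K (Si b * a) y) z) h = K 1 h"
proof -
  have "sw sc (\<lambda>a z. sw sc (\<lambda>b y. K (Si (S a * b)) y) z) h = K (Si 1) h"
    by (rule sw_antip_cancel_left[where K="\<lambda>t y. K (Si t) y"]) (rule lin_comp[OF linear_Si assms(1)] assms(2))+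
  then show ?thesis by (simp add: Si_mult Si_one)
qed

lemma ct_Si_mult: "ct 1 1 (Si a) \<odot> ct b f g = sf (\<lambda>g1 z. sf (\<lambda>g2 g3. sf (\<lambda>a1 z. sf (\<lambda>a2 z. sf (\<lambda>a3 a4.
    ct ((Si a4 \<rhd> b) * \<sigma> (Si a3) g1) (f * \<sigma> (S g3) a1) (Si a2 * g2)) z) z) a) z) g"
proof -
  have 1: "sf (\<lambda>a1 z. sf (\<lambda>a2 z. sf (\<lambda>a3 a4. sf (\<lambda>g2 g3. F a1 a2 a3 a4 g2 g3) y) z) z) a =
    sf (\<lambda>g2 g3. sf (\<lambda>a1 z. sf (\<lambda>a2 z. sf (\<lambda>a3 a4. F a1 a2 a3 a4 g2 g3) z) z) a) y"
    for F :: "'h \<Rightarrow> 'h \<Rightarrow> 'h \<Rightarrow> 'h \<Rightarrow> 'h \<Rightarrow> 'h \<Rightarrow> ('k, 'h, 'b) cr" and y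
    by (simp add: sw_swap[where g=y])
  show ?thesis
    by (simp add: cm_ct sw_Si act_on_one counit_scales sw_assoc counit_antip sw_swap[where g=g]) (simp add: 1)
qed

text \<open>The second tensor factor of the axiom for the inverse: the cocycle pair in the second
  slot cancels, then \<open>Si a2 * g2\<close> becomes 1. The coefficient in the first slot remains
  and is carried by a source element, ready to cross the tensor sign.\<close>

lemma cop_mult_snd_collapse:
  "sf (\<lambda>h1 z. sf (\<lambda>h2 z. sf (\<lambda>h3 a. ct 1 1 (Si a) \<odot> ct b (\<tau> (S h2) h3) h1) z) z) w =
   src_el (sb (\<lambda>w1 z. sb (\<lambda>w2 w3. (Si w3 \<rhd> b) * \<sigma> (Si w2) w1) z) w)" (is "?l = _")
proof -
  have 0: "sf (\<lambda>h2 z. sf (\<lambda>h3 a. ct 1 1 (Si a) \<odot> ct b (\<tau> (S h2) h3) h1) z) z =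
    sf (\<lambda>g1 y. sf (\<lambda>g2 g3. sf (\<lambda>h2 z. sf (\<lambda>h3 a. sf (\<lambda>a1 z. sf (\<lambda>a2 z. sf (\<lambda>a3 a4.
    ct ((Si a4 \<rhd> b) * \<sigma> (Si a3) g1) (\<tau> (S h2) h3 * \<sigma> (S g3) a1) (Si a2 * g2)) z) z) a) z) z) y) h1" for h1 z
    unfolding ct_Si_mult by (rule sw_pull)
  have 1: "sf (\<lambda>y1 y2. sf (\<lambda>v2 z. sf (\<lambda>v3 v4. F v2 v3 v4 y1 y2) z) z) y =
    sf (\<lambda>v2 z. sf (\<lambda>v3 v4. sf (\<lambda>y1 y2. F v2 v3 v4 y1 y2) y) z) z"
    for F :: "'h \<Rightarrow> 'h \<Rightarrow> 'h \<Rightarrow> 'h \<Rightarrow> 'h \<Rightarrow> ('k, 'h, 'b) cr" and y z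
    by (simp add: sw_swap[where h=y])
  have "?l = sf (\<lambda>g1 z. sf (\<lambda>g2 z. sf (\<lambda>u z. sf (\<lambda>y z. sf (\<lambda>u1 u2. sf (\<lambda>y1 y2. sf (\<lambda>a2 z. sf (\<lambda>a3 a4.
    ct ((Si a4 \<rhd> b) * \<sigma> (Si a3) g1) (1 * (\<tau> (S u2) y1 * \<sigma> (S u1) y2)) (Si a2 * g2)) z) z) y) u) z) z) z) w"
    unfolding 0 by (simp add: sw_assoc sw_assoc_pair lin_intros)
  also have "\<dots> = sf (\<lambda>g1 z. sf (\<lambda>g2 z. sf (\<lambda>a2 z. sf (\<lambda>a3 a4.
    ct ((Si a4 \<rhd> b) * \<sigma> (Si a3) g1) 1 (Si a2 * g2)) z) z) z) w"
    unfolding 1 sw_cocinv_coc_pair by (simp add: counit_scales)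
  also have "\<dots> = sf (\<lambda>g1 z. sf (\<lambda>a3 a4. ct ((Si a4 \<rhd> b) * \<sigma> (Si a3) g1) 1 1) z) w"
    by (subst sw_Si_cancel[where K="\<lambda>t z. sf (\<lambda>a3 a4. ct ((Si a4 \<rhd> b) * \<sigma> (Si a3) _) 1 t) z"]) (simp_all add: lin_intros)
  finally show ?thesis by (simp add: src_el_def sw_pushes)
qed

lemma ct_unit: "tgt_el a = tgt_el a \<odot> ct 1 1 1" "src_el a = src_el a \<odot> ct 1 1 1"
proof -
  have "tgt_el a \<odot> ct 1 1 1 = ct 1 a 1" by (simp add: tgt_ct sw_one lin_intros antip_one one_act)
  then show "tgt_el a = tgt_el a \<odot> ct 1 1 1" by (simp add: tgt_el_def)
  have "src_el a \<odot> ct 1 1 1 = ct a 1 1" by (simp add: src_ct)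
  then show "src_el a = src_el a \<odot> ct 1 1 1" by (simp add: src_el_def)
qed

text \<open>The trailing legs \<open>k5\<close>, \<open>k6\<close>, \<open>a\<close>,
  \<open>p\<close>, \<open>q\<close>, \<open>v\<close> make up the first tensor factor, which
  collapses to a target element. Moved across the tensor sign, it multiplies the other factor by
  \<open>c\<close> and completes it to the antipode.\<close>

lemma antipode_axiom_right_ct:
  "sf (\<lambda>h1 z. sf (\<lambda>h2 z. sf (\<lambda>h3 h4.
     cop_mult_fst (ct 1 c h4) (anti (ct b (\<tau> (S h2) h3) h1))) z) z) h = bal (ct 1 1 1) (anti (ct b c h))" (is "?l = ?r")
proof -
  have 1: "sf (\<lambda>k5 z. sf (\<lambda>k6 z. sf (\<lambda>a z. sf (\<lambda>p z. sf (\<lambda>q v.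
     bal (ct (\<tau> (S p) q) (\<tau> (S (S k6)) (S k5)) (S a) \<odot> ct 1 c v) Y) z) z) z) z) w = fscale (\<epsilon> w) (bal (tgt_el c) Y)" for w Y
    unfolding sw_bal_left[symmetric] cop_mult_fst_collapse lin_scale[OF linear_bal(1)] ..
  have 2: "bal (tgt_el c) (ct d e k) = bal (ct 1 1 1) (ct (c * d) e k)" for d e k
    by (subst ct_unit, subst bal_balanced) (simp_all add: src_ct)
  have 3: "cop_mult_fst V (anti (ct b e k)) = sf (\<lambda>k1 z. sf (\<lambda>k2 z. sf (\<lambda>k3 z. sf (\<lambda>k4 z. sf (\<lambda>k5 z. sf (\<lambda>k6 a.
     bal (ct e (\<tau> (S (S k6)) (S k5)) (S a) \<odot> V) (ct 1 (\<tau> (S (S k2)) (S k1) * (S (S k3) \<rhd> b)) (S k4))) z) z) z) z) z) k"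
    for V e k
    by (simp add: anti_ct sw_cop_mult_fst cop_mult_fst_ct sw_antip lin_maps) (simp add: sw_assoc lin_maps)
  have 4: "sf (\<lambda>p z. sf (\<lambda>q v. sf (\<lambda>x y. F p q v x y) k) z) w = sf (\<lambda>x y. sf (\<lambda>p z. sf (\<lambda>q v. F p q v x y) z) w) k"
    for F :: "'h \<Rightarrow> 'h \<Rightarrow> 'h \<Rightarrow> 'h \<Rightarrow> 'h \<Rightarrow> ('k, 'h, 'b) cr \<times> ('k, 'h, 'b) cr \<Rightarrow>\<^sub>0 'k" and k w
    by (simp add: sw_swap[where g=k])
  have 5: "sf (\<lambda>p z. sf (\<lambda>q v. cop_mult_fst (ct 1 c v) (anti (ct b (\<tau> (S p) q) k))) z) w =
    sf (\<lambda>k1 z. sf (\<lambda>k2 z. sf (\<lambda>k3 z. sf (\<lambda>k4 z. sf (\<lambda>k5 z. sf (\<lambda>k6 a. sf (\<lambda>p z. sf (\<lambda>q v.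
     bal (ct (\<tau> (S p) q) (\<tau> (S (S k6)) (S k5)) (S a) \<odot> ct 1 c v)
      (ct 1 (\<tau> (S (S k2)) (S k1) * (S (S k3) \<rhd> b)) (S k4))) z) w) z) z) z) z) z) k" for k w
    by (simp add: 3 4[of _ _ w])
  have "?l = sf (\<lambda>k1 z. sf (\<lambda>k2 z. sf (\<lambda>k3 z. sf (\<lambda>k4 z. sf (\<lambda>k5 z. sf (\<lambda>k6 z. sf (\<lambda>a z. sf (\<lambda>p z. sf (\<lambda>q v.
     bal (ct (\<tau> (S p) q) (\<tau> (S (S k6)) (S k5)) (S a) \<odot> ct 1 c v)
        (ct 1 (\<tau> (S (S k2)) (S k1) * (S (S k3) \<rhd> b)) (S k4))) z) z) z) z) z) z) z) z) h"
    unfolding 5 by (simp add: sw_assoc lin_maps)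
  also have "\<dots> = sf (\<lambda>k1 z. sf (\<lambda>k2 z. sf (\<lambda>k3 k4.
     bal (tgt_el c) (ct 1 (\<tau> (S (S k2)) (S k1) * (S (S k3) \<rhd> b)) (S k4))) z) z) h"
    unfolding 1 by (simp add: counits lin_maps)
  also have "\<dots> = ?r"
    by (simp add: 2 anti_ct sw_bal_right)
  finally show ?thesis .
qed

text \<open>The second tensor factor collapses to a source element. Across the tensor sign it
  becomes a target element, and its coefficient meets \<open>\<tau>\<close> in the second slot of
  the first factor, where \<open>anti_anti_inv_coefficient_Si\<close> leaves just
  \<open>b\<close>.\<close>

lemma antipode_axiom_left_ct:
  "sf (\<lambda>h1 z. sf (\<lambda>h2 z. sf (\<lambda>h3 h4.
     cop_mult_snd (ct b (\<tau> (S h2) h3) h1) (anti_inv (ct 1 c h4))) z) z) h = bal (anti_inv (ct b c h)) (ct 1 1 1)" (is "?l = ?r")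
proof -
  \<comment> \<open>\<open>A\<close> seals the coefficient formed from the trailing leg, so that
    this leg is not split while the others are rearranged.\<close>
  define A where "A z = sb (\<lambda>p2 z. sb (\<lambda>p3 p4. (p2 \<rhd> c) * \<sigma> p3 (S p4)) z) z" for z
  have lA: "lin s bs (\<lambda>x. A (f x))" if "lin s hs f" for s f
    unfolding A_def using that by (simp add: lin_intros)
  let ?Q = "\<lambda>w. sb (\<lambda>w1 z. sb (\<lambda>w2 w3. (Si w3 \<rhd> b) * \<sigma> (Si w2) w1) z) w"
  have T: "anti_inv (ct e c h) = sf (\<lambda>h1 z. ct (A z) e (Si h1)) h" for e h
    by (simp add: anti_inv_ct sw_pushes A_def)
  have 1: "sf (\<lambda>h1 z. sf (\<lambda>h2 z. sf (\<lambda>h3 a. bal Y (ct 1 1 (Si a) \<odot> ct b (\<tau> (S h2) h3) h1)) z) z) w =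
     bal Y (src_el (?Q w))" for w Y
    unfolding sw_bal_right[symmetric] cop_mult_snd_collapse ..
  have 2: "bal (ct d e (Si k)) (src_el a) = sf (\<lambda>d1 d2. bal (ct d (e * (d1 \<rhd> a)) (Si d2)) (ct 1 1 1)) k" for d e a k
    by (subst ct_unit(2), subst bal_balanced[symmetric]) (simp_all add: tgt_ct sw_Si lin_intros sw_bal_left)
  have 3: "sf (\<lambda>h1 z. sf (\<lambda>h2 z. sf (\<lambda>h3 z. sf (\<lambda>h4 z. sf (\<lambda>h5 h6.
     ct d (\<tau> h5 (Si h4) * (h6 \<rhd> ((Si h3 \<rhd> b) * \<sigma> (Si h2) h1))) k) z) z) z) z) w = fscale (\<epsilon> w) (ct d b k)" for d k w
    unfolding sw_ct2[symmetric] anti_anti_inv_coefficient_Si scale_pushes ..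
  have 4: "sf (\<lambda>x2 y. sf (\<lambda>x3 y. sf (\<lambda>x4 r. sf (\<lambda>p q. F x2 x3 x4 r p q) k) y) y) z =
      sf (\<lambda>p q. sf (\<lambda>x2 y. sf (\<lambda>x3 y. sf (\<lambda>x4 r. F x2 x3 x4 r p q) y) y) z) k"
    for F :: "'h \<Rightarrow> 'h \<Rightarrow> 'h \<Rightarrow> 'h \<Rightarrow> 'h \<Rightarrow> 'h \<Rightarrow> ('k, 'h, 'b) cr \<times> ('k, 'h, 'b) cr \<Rightarrow>\<^sub>0 'k" and k z
    by (simp add: sw_swap[where g=k])
  have 5: "sf (\<lambda>x2 y. sf (\<lambda>x3 y. sf (\<lambda>d1 y. sf (\<lambda>x4 r. sf (\<lambda>p q. F x2 x3 d1 x4 r p q) k) y) y) y) z =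
      sf (\<lambda>p q. sf (\<lambda>x2 y. sf (\<lambda>x3 y. sf (\<lambda>d1 y. sf (\<lambda>x4 r. F x2 x3 d1 x4 r p q) y) y) y) z) k"
    for F :: "'h \<Rightarrow> 'h \<Rightarrow> 'h \<Rightarrow> 'h \<Rightarrow> 'h \<Rightarrow> 'h \<Rightarrow> 'h \<Rightarrow> ('k, 'h, 'b) cr \<times> ('k, 'h, 'b) cr \<Rightarrow>\<^sub>0 'k" and k z
    by (simp add: sw_swap[where g=k])
  \<comment> \<open>The splits of \<open>w\<close> and \<open>z\<close> are independent, so the
    block over \<open>w\<close> can be placed innermost and collapsed by \<open>1\<close>.\<close>
  have 6: "sf (\<lambda>x2 z. sf (\<lambda>x3 z. sf (\<lambda>x4 z. sf (\<lambda>h1 y. sf (\<lambda>h2 y. sf (\<lambda>h3 a.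
      bal (ct (A z) (\<tau> x3 (Si x2)) (Si x4)) (ct 1 1 (Si a) \<odot> ct b (\<tau> (S h2) h3) h1)) y) y) w) z) z) z =
    sf (\<lambda>h1 y. sf (\<lambda>h2 y. sf (\<lambda>h3 a. sf (\<lambda>x2 z. sf (\<lambda>x3 z. sf (\<lambda>x4 z.
      bal (ct (A z) (\<tau> x3 (Si x2)) (Si x4)) (ct 1 1 (Si a) \<odot> ct b (\<tau> (S h2) h3) h1)) z) z) z) y) y) w" for w z
    by (simp add: 4[of _ _ z])
  have 7: "sf (\<lambda>x2 z. sf (\<lambda>x3 z. sf (\<lambda>x4 z. bal (ct (A z) (\<tau> x3 (Si x2)) (Si x4)) (src_el (?Q w))) z) z) z =
    sf (\<lambda>w1 y. sf (\<lambda>w2 w3. sf (\<lambda>x2 z. sf (\<lambda>x3 z. sf (\<lambda>d1 z. sf (\<lambda>d2 z.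
      bal (ct (A z) (\<tau> x3 (Si x2) * (d1 \<rhd> ((Si w3 \<rhd> b) * \<sigma> (Si w2) w1))) (Si d2)) (ct 1 1 1)) z) z) z) z) y) w" for w z
    by (simp add: 2 sw_assoc lin_maps lA) (simp add: sw_act_right sw_bmult_right sw_ct2 sw_bal_left 5[of _ _ z])
  have 8: "sf (\<lambda>d2 r. bal (sf (\<lambda>h1 z. sf (\<lambda>h2 z. sf (\<lambda>h3 z. sf (\<lambda>h4 z. sf (\<lambda>h5 h6.
     ct (A r) (\<tau> h5 (Si h4) * (h6 \<rhd> ((Si h3 \<rhd> b) * \<sigma> (Si h2) h1))) (Si d2)) z) z) z) z) w) (ct 1 1 1)) y =
     sf (\<lambda>h1 z. sf (\<lambda>h2 z. sf (\<lambda>h3 z. sf (\<lambda>h4 z. sf (\<lambda>h5 h6. sf (\<lambda>d2 r.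
     bal (ct (A r) (\<tau> h5 (Si h4) * (h6 \<rhd> ((Si h3 \<rhd> b) * \<sigma> (Si h2) h1))) (Si d2)) (ct 1 1 1)) y) z) z) z) z) w" for w y
    by (simp add: sw_bal_left sw_swap[where h=y])
  have "?l = sf (\<lambda>h1 z. sf (\<lambda>h2 z. sf (\<lambda>h3 z. sf (\<lambda>a z. sf (\<lambda>x2 z. sf (\<lambda>x3 z. sf (\<lambda>x4 z.
      bal (ct (A z) (\<tau> x3 (Si x2)) (Si x4)) (ct 1 1 (Si a) \<odot> ct b (\<tau> (S h2) h3) h1)) z) z) z) z) z) z) h"
    unfolding T by (simp add: sw_cop_mult_snd cop_mult_snd_ct sw_Si lin_maps lA) (simp add: sw_assoc lin_maps lA)
  also have "\<dots> = sf (\<lambda>w z. sf (\<lambda>x2 z. sf (\<lambda>x3 z. sf (\<lambda>x4 z.  sf (\<lambda>h1 y. sf (\<lambda>h2 y. sf (\<lambda>h3 a.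
      bal (ct (A z) (\<tau> x3 (Si x2)) (Si x4)) (ct 1 1 (Si a) \<odot> ct b (\<tau> (S h2) h3) h1)) y) y) w) z) z) z) h"
    unfolding 6 by (simp add: sw_assoc lin_maps lA)
  also have "\<dots> = sf (\<lambda>w z. sf (\<lambda>x2 z. sf (\<lambda>x3 z. sf (\<lambda>x4 z.
      bal (ct (A z) (\<tau> x3 (Si x2)) (Si x4)) (src_el (?Q w))) z) z) z) h"
    unfolding 1 ..
  also have "\<dots> = sf (\<lambda>w y. sf (\<lambda>d2 r. bal (sf (\<lambda>h1 z. sf (\<lambda>h2 z. sf (\<lambda>h3 z. sf (\<lambda>h4 z. sf (\<lambda>h5 h6.
     ct (A r) (\<tau> h5 (Si h4) * (h6 \<rhd> ((Si h3 \<rhd> b) * \<sigma> (Si h2) h1))) (Si d2)) z) z) z) z) w) (ct 1 1 1)) y) h"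
    unfolding 7 8 by (simp add: sw_assoc lin_maps lA)
  also have "\<dots> = ?r"
    unfolding 3 T by (simp add: lin_scale[OF linear_bal(1)] pull_scale counits lin_maps lA sw_bal_left)
  finally show ?thesis .
qed

lemma left_antipode_anti: "left_antipode L anti" "\<And>X. X \<in> cr_car \<Longrightarrow> inv_into cr_car anti X = anti_inv X"
proof -
  have bij: "bij_betw anti cr_car cr_car"
    by (rule bij_betw_byWitness[where f'=anti_inv]) (auto simp: anti_inv_anti anti_anti_inv)
  show inv: "inv_into cr_car anti X = anti_inv X" if "X \<in> cr_car" for X
    using that bij by (metis anti_anti_inv anti_inv_in_car bij_betw_inv_into_left)
  have c2: "lin_ext fscale (\<lambda>(X1, X2). lin_ext fscale (\<lambda>(Y1, Y2). btens L Y1 (Y2 \<odot> X1))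
         (cop L (inv_into cr_car anti X2))) (cop L X) = btens L (inv_into cr_car anti X) (ct 1 1 1)" if "X \<in> cr_car" for X
  proof -
    have "lin_ext fscale (\<lambda>(X1, X2). lin_ext fscale (\<lambda>(Y1, Y2). btens L Y1 (Y2 \<odot> X1))
         (cop L (inv_into cr_car anti X2))) (cop L X) =
       lin_ext fscale (\<lambda>(b, c, h). sf (\<lambda>h1 z. sf (\<lambda>h2 z. sf (\<lambda>h3 h4.
         cop_mult_snd (ct b (\<tau> (S h2) h3) h1) (anti_inv (ct 1 c h4))) z) z) h) X"
      \<comment> \<open>On the carrier \<open>inv_into\<close> may be replaced by
        \<open>anti_inv\<close>, which is linear everywhere as \<open>F\<close> requires.\<close>
      by (rule lin_ext_cop[where F="\<lambda>X1 X2. cop_mult_snd X1 (anti_inv X2)"])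
         (simp_all add: lin_cops lin_ext_cop_mult_snd inv anti_inv_src cop_mult_snd_tgt)
    also have "\<dots> = bal (anti_inv X) (ct 1 1 1)"
      by (rule lin_eq_on_car[where t=fscale, OF _ _ _ that]) (simp_all add: lin_lin_ext_arg lin_cops lin_ext_ct antipode_axiom_left_ct)
    finally show ?thesis using that by (simp add: btens_L btens_eq_bal inv)
  qed
  have c3: "lin_ext fscale (\<lambda>(X1, X2). lin_ext fscale (\<lambda>(Y1, Y2). btens L (Y1 \<odot> X2) Y2)
         (cop L (anti X1))) (cop L X) = btens L (ct 1 1 1) (anti X)" if "X \<in> cr_car" for X
  proof -
    have "lin_ext fscale (\<lambda>(X1, X2). lin_ext fscale (\<lambda>(Y1, Y2). btens L (Y1 \<odot> X2) Y2)
         (cop L (anti X1))) (cop L X) =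
       lin_ext fscale (\<lambda>(b, c, h). sf (\<lambda>h1 z. sf (\<lambda>h2 z. sf (\<lambda>h3 h4.
         cop_mult_fst (ct 1 c h4) (anti (ct b (\<tau> (S h2) h3) h1))) z) z) h) X"
      by (rule lin_ext_cop[where F="\<lambda>X1 X2. cop_mult_fst X2 (anti X1)"])
         (simp_all add: lin_cops lin_ext_cop_mult_fst anti_tgt cop_mult_fst_src)
    also have "\<dots> = bal (ct 1 1 1) (anti X)"
      by (rule lin_eq_on_car[where t=fscale, OF _ _ _ that]) (simp_all add: lin_lin_ext_arg lin_cops lin_ext_ct antipode_axiom_right_ct)
    finally show ?thesis using that by (simp add: btens_L btens_eq_bal)
  qed
  show "left_antipode L anti"
    unfolding left_antipode_def
    by (simp add: bij inv c2 c3 anti_tgt anti_inv_src lin_add[OF lin_anti[OF lin_ident]] lin_scale[OF lin_anti[OF lin_ident]])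
qed

end

theorem proposition3p10:
  fixes H :: "('k::field, 'h::ring_1) hopf_data"
    and C :: "('k, 'h, 'b::{ring,monoid_mult}) cocycle_data"
  assumes "hopf_algebra H"
    and "bij (antip H)"
    and "assoc_cocycle_cross_product H C"
  shows "\<exists>S. left_antipode (cr_bialgebroid H C) S \<and>
    (\<forall>b b' h. S (cr_tens H C b b' h) =
       sw4 H fscale (\<lambda>h1 h2 h3 h4.
         cr_tens H C b'
           (cocinv C (antip H (antip H h2)) (antip H h1) * act C (antip H (antip H h3)) b)
           (antip H h4)) h) \<and>
    (\<forall>b b' h. inv_into (car (cr_bialgebroid H C)) S (cr_tens H C b b' h) =
       sw4 H fscale (\<lambda>h1 h2 h3 h4.
         cr_tens H C (act C h2 b' * coc C h3 (antip H h4)) b (inv (antip H) h1)) h)"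
proof -
  interpret cr_bialgebroid_setup H C
    using assms by (simp add: cr_bialgebroid_setup_def cr_bialgebroid_setup_axioms_def)
  show ?thesis
    by (intro exI[of _ anti] conjI allI left_antipode_anti(1))
      (simp_all add: anti_ct left_antipode_anti(2) anti_inv_ct sw4_eq sw3_eq Si_def)
qed

end
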